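(* Let $R$ be a commutative ring with $1$, let $m\ge 0$ and $n\ge 1$ be integers, and let $E^m$ be the Grassmann algebra of rank $m$ over $R$. Then the standard identity of degree $k=2n(\lfloor m/2\rfloor+1)$ holds in the ring $M_nE^m$ of $n\times n$ matrices over $E^m$.
   Context: The Grassmann algebra of rank $m$ over $R$ is the $R$-algebra $E^m=R\langle v_1,\dots,v_m\rangle/(v_k^2,\ v_iv_j+v_jv_i\mid 1\le k\le m,\ 1\le i<j\le m)$. The standard polynomial $s_k$ is the polynomial in noncommuting variables $$s_k(x_1,\dots,x_k)=\sum_{\pi\in\mathfrak S_k}(-1)^\pi\, x_{\pi(1)}x_{\pi(2)}\cdots x_{\pi(k)},$$ where $\mathfrak S_k$ is the symmetric group on $\{1,\dots,k\}$ and $(-1)^\pi$ is the sign of $\pi$. The standard identity of degree $k$ holds in a ring $\mathfrak A$ if $s_k(x_1,\dots,x_k)=0$ for all $x_1,\dots,x_k\in\mathfrak A$. *)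

theory Defs
  imports
    "HOL-Algebra.QuotRing"
    "HOL-Combinatorics.Permutations"
    "Jordan_Normal_Form.Matrix"
begin

section \<open>Free algebras and Grassmann algebras\<close>

text \<open>An element of \<open>R\<langle>v\<^sub>1,\<dots>,v\<^sub>m\<rangle>\<close> is a finitely supported function
  from words over \<open>{1..m}\<close> to coefficients. The coefficient of a product at a word \<open>w\<close> is
  the sum over all ways to cut \<open>w\<close> into a prefix and a suffix. Scalars are the functions
  supported on the empty word, so two-sided ring ideals are the same as algebra ideals.\<close>

definition free_algebra :: "('a, 'b) ring_scheme \<Rightarrow> nat \<Rightarrow> (nat list \<Rightarrow> 'a) ring" where
  "free_algebra R m =
    \<lparr> carrier = {f. range f \<subseteq> carrier R \<and> finite {w. f w \<noteq> \<zero>\<^bsub>R\<^esub>} \<and>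
                    (\<forall>w. f w \<noteq> \<zero>\<^bsub>R\<^esub> \<longrightarrow> set w \<subseteq> {1..m})},
      monoid.mult = (\<lambda>f g w. \<Oplus>\<^bsub>R\<^esub>i\<in>{..length w}. f (take i w) \<otimes>\<^bsub>R\<^esub> g (drop i w)),
      one = (\<lambda>w. if w = [] then \<one>\<^bsub>R\<^esub> else \<zero>\<^bsub>R\<^esub>),
      zero = (\<lambda>w. \<zero>\<^bsub>R\<^esub>),
      add = (\<lambda>f g w. f w \<oplus>\<^bsub>R\<^esub> g w) \<rparr>"

definition free_var :: "('a, 'b) ring_scheme \<Rightarrow> nat \<Rightarrow> nat list \<Rightarrow> 'a" where
  "free_var R i = (\<lambda>w. if w = [i] then \<one>\<^bsub>R\<^esub> else \<zero>\<^bsub>R\<^esub>)"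

definition grassmann_relations :: "('a, 'b) ring_scheme \<Rightarrow> nat \<Rightarrow> (nat list \<Rightarrow> 'a) set" where
  "grassmann_relations R m =
    (let F = free_algebra R m; v = free_var R in
      {v k \<otimes>\<^bsub>F\<^esub> v k | k. 1 \<le> k \<and> k \<le> m} \<union>
      {v i \<otimes>\<^bsub>F\<^esub> v j \<oplus>\<^bsub>F\<^esub> v j \<otimes>\<^bsub>F\<^esub> v i | i j. 1 \<le> i \<and> i < j \<and> j \<le> m})"

definition grassmann_algebra :: "('a, 'b) ring_scheme \<Rightarrow> nat \<Rightarrow> (nat list \<Rightarrow> 'a) set ring" where
  "grassmann_algebra R m =
    free_algebra R m Quot (Idl\<^bsub>free_algebra R m\<^esub> (grassmann_relations R m))"

section \<open>Matrix rings\<close>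

text \<open>The ring \<open>ring_mat\<close> of the imported matrix theory takes its entries from a type class;
  here they are taken from the carrier of a ring record.\<close>

definition matrix_ring :: "nat \<Rightarrow> ('a, 'b) ring_scheme \<Rightarrow> 'a mat ring" where
  "matrix_ring n A =
    \<lparr> carrier = {M \<in> carrier_mat n n. elements_mat M \<subseteq> carrier A},
      monoid.mult = (\<lambda>M N. mat n n (\<lambda>(i, j). \<Oplus>\<^bsub>A\<^esub>l\<in>{..<n}. M $$ (i, l) \<otimes>\<^bsub>A\<^esub> N $$ (l, j))),
      one = mat n n (\<lambda>(i, j). if i = j then \<one>\<^bsub>A\<^esub> else \<zero>\<^bsub>A\<^esub>),
      zero = mat n n (\<lambda>_. \<zero>\<^bsub>A\<^esub>),
      add = (\<lambda>M N. mat n n (\<lambda>ij. M $$ ij \<oplus>\<^bsub>A\<^esub> N $$ ij)) \<rparr>"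

section \<open>The standard identity\<close>

definition standard_poly :: "('a, 'b) ring_scheme \<Rightarrow> nat \<Rightarrow> (nat \<Rightarrow> 'a) \<Rightarrow> 'a" where
  "standard_poly A k x =
    (\<Oplus>\<^bsub>A\<^esub>\<pi>\<in>{\<pi>. \<pi> permutes {1..k}}.
      [sign \<pi>] \<cdot>\<^bsub>A\<^esub> foldr (\<otimes>\<^bsub>A\<^esub>) (map (\<lambda>i. x (\<pi> i)) [1..<Suc k]) \<one>\<^bsub>A\<^esub>)"

definition standard_identity :: "('a, 'b) ring_scheme \<Rightarrow> nat \<Rightarrow> bool" where
  "standard_identity A k \<longleftrightarrow>
    (\<forall>x. x \<in> {1..k} \<rightarrow> carrier A \<longrightarrow> standard_poly A k x = \<zero>\<^bsub>A\<^esub>)"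

section \<open>The constructions are rings\<close>

lemma (in abelian_monoid) finsum_triangle:
  assumes "\<And>i j. F i j \<in> carrier G"
  shows "(\<Oplus>i\<in>{..n::nat}. \<Oplus>j\<in>{..i}. F i j) = (\<Oplus>j\<in>{..n}. \<Oplus>i\<in>{..n - j}. F (j + i) j)"
proof (induction n)
  case 0
  then show ?case by (simp add: assms)
next
  case (Suc n)
  have "(\<Oplus>j\<in>{..n}. \<Oplus>i\<in>{..Suc n - j}. F (j + i) j)
      = (\<Oplus>j\<in>{..n}. F (Suc n) j \<oplus> (\<Oplus>i\<in>{..n - j}. F (j + i) j))"
    by (rule finsum_cong') (auto simp: Suc_diff_le assms Pi_def)
  also have "\<dots> = (\<Oplus>j\<in>{..n}. F (Suc n) j) \<oplus> (\<Oplus>j\<in>{..n}. \<Oplus>i\<in>{..n - j}. F (j + i) j)"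
    by (rule finsum_addf) (auto simp: assms Pi_def)
  finally have "(\<Oplus>j\<in>{..Suc n}. \<Oplus>i\<in>{..Suc n - j}. F (j + i) j)
      = F (Suc n) (Suc n) \<oplus> ((\<Oplus>j\<in>{..n}. F (Suc n) j) \<oplus> (\<Oplus>j\<in>{..n}. \<Oplus>i\<in>{..n - j}. F (j + i) j))"
    by (subst finsum_Suc) (auto simp: assms Pi_def)
  then show ?case
    by (simp add: Suc.IH assms Pi_def a_ac)
qed

lemma (in abelian_monoid) finsum_exchange:
  assumes "finite A" "finite B" "\<And>i j. i \<in> A \<Longrightarrow> j \<in> B \<Longrightarrow> F i j \<in> carrier G"
  shows "(\<Oplus>i\<in>A. \<Oplus>j\<in>B. F i j) = (\<Oplus>j\<in>B. \<Oplus>i\<in>A. F i j)"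
  using assms
proof (induction A rule: finite_induct)
  case empty
  then show ?case by (simp add: finsum_zero)
next
  case (insert a A)
  have "(\<Oplus>j\<in>B. \<Oplus>i\<in>insert a A. F i j) = (\<Oplus>j\<in>B. F a j \<oplus> (\<Oplus>i\<in>A. F i j))"
    using insert by (intro finsum_cong') (auto intro!: finsum_insert)
  also have "\<dots> = (\<Oplus>j\<in>B. F a j) \<oplus> (\<Oplus>j\<in>B. \<Oplus>i\<in>A. F i j)"
    using insert by (intro finsum_addf) auto
  finally show ?case
    using insert by (subst finsum_insert) auto
qed

lemma ring_free_algebra:
  fixes R (structure)
  assumes "cring R"
  shows "ring (free_algebra R m)"
proof -
  interpret cring R by fact
  let ?F = "free_algebra R m"
  have car: "f w \<in> carrier R" if "f \<in> carrier ?F" for f w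
    using that by (auto simp: free_algebra_def)
  have fin: "finite {w. f w \<noteq> \<zero>}" if "f \<in> carrier ?F" for f
    using that by (auto simp: free_algebra_def)
  have supp: "set w \<subseteq> {1..m}" if "f \<in> carrier ?F" "f w \<noteq> \<zero>" for f w
    using that by (auto simp: free_algebra_def)
  have carI: "f \<in> carrier ?F" if "\<And>w. f w \<in> carrier R" "finite S" "\<And>w. f w \<noteq> \<zero> \<Longrightarrow> w \<in> S"
      "\<And>w. f w \<noteq> \<zero> \<Longrightarrow> set w \<subseteq> {1..m}" for f S
  proof -
    have "finite {w. f w \<noteq> \<zero>}" by (rule finite_subset[OF _ that(2)]) (use that(3) in auto)
    then show ?thesis using that(1,4) by (auto simp: free_algebra_def)
  qed
  have mul: "(f \<otimes>\<^bsub>?F\<^esub> g) w = (\<Oplus>i\<in>{..length w}. f (take i w) \<otimes> g (drop i w))" for f g w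
    by (simp add: free_algebra_def)
  have one: "\<one>\<^bsub>?F\<^esub> w = (if w = [] then \<one> else \<zero>)" for w
    by (simp add: free_algebra_def)
  have zero: "\<zero>\<^bsub>?F\<^esub> w = \<zero>" for w
    by (simp add: free_algebra_def)
  have add: "(f \<oplus>\<^bsub>?F\<^esub> g) w = f w \<oplus> g w" for f g w
    by (simp add: free_algebra_def)
  have add_closed: "f \<oplus>\<^bsub>?F\<^esub> g \<in> carrier ?F" if "f \<in> carrier ?F" "g \<in> carrier ?F" for f g
  proof (rule carI[of _ "{w. f w \<noteq> \<zero>} \<union> {w. g w \<noteq> \<zero>}"])
    have *: "f w \<noteq> \<zero> \<or> g w \<noteq> \<zero>" if "(f \<oplus>\<^bsub>?F\<^esub> g) w \<noteq> \<zero>" for w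
      using that by (auto simp: add)
    show "w \<in> {w. f w \<noteq> \<zero>} \<union> {w. g w \<noteq> \<zero>}" if "(f \<oplus>\<^bsub>?F\<^esub> g) w \<noteq> \<zero>" for w
      using *[OF that] by auto
    show "set w \<subseteq> {1..m}" if "(f \<oplus>\<^bsub>?F\<^esub> g) w \<noteq> \<zero>" for w
      using *[OF that] supp \<open>f \<in> _\<close> \<open>g \<in> _\<close> by blast
  qed (use that in \<open>auto simp: add car fin\<close>)
  have mul_closed: "f \<otimes>\<^bsub>?F\<^esub> g \<in> carrier ?F" if "f \<in> carrier ?F" "g \<in> carrier ?F" for f g
  proof (rule carI[of _ "(\<lambda>(u, v). u @ v) ` ({w. f w \<noteq> \<zero>} \<times> {w. g w \<noteq> \<zero>})"])
    have *: "\<exists>i. f (take i w) \<noteq> \<zero> \<and> g (drop i w) \<noteq> \<zero>" if nz: "(f \<otimes>\<^bsub>?F\<^esub> g) w \<noteq> \<zero>" for w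
    proof (rule ccontr)
      assume "\<not> ?thesis"
      then have "f (take i w) \<otimes> g (drop i w) = \<zero>" for i
        using car \<open>f \<in> _\<close> \<open>g \<in> _\<close> by (metis l_null r_null)
      then show False using nz by (simp add: mul finsum_zero)
    qed
    show "w \<in> (\<lambda>(u, v). u @ v) ` ({w. f w \<noteq> \<zero>} \<times> {w. g w \<noteq> \<zero>})"
      if "(f \<otimes>\<^bsub>?F\<^esub> g) w \<noteq> \<zero>" for w
    proof -
      obtain i where "f (take i w) \<noteq> \<zero>" "g (drop i w) \<noteq> \<zero>" using *[OF \<open>(f \<otimes>\<^bsub>?F\<^esub> g) w \<noteq> \<zero>\<close>] by blast
      then show ?thesis by (intro image_eqI[of _ _ "(take i w, drop i w)"]) auto
    qed
    show "set w \<subseteq> {1..m}" if "(f \<otimes>\<^bsub>?F\<^esub> g) w \<noteq> \<zero>" for w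
    proof -
      obtain i where "f (take i w) \<noteq> \<zero>" "g (drop i w) \<noteq> \<zero>" using *[OF \<open>(f \<otimes>\<^bsub>?F\<^esub> g) w \<noteq> \<zero>\<close>] by blast
      then have "set (take i w @ drop i w) \<subseteq> {1..m}"
        using supp \<open>f \<in> _\<close> \<open>g \<in> _\<close> unfolding set_append by blast
      then show ?thesis by simp
    qed
  qed (use that in \<open>auto simp: mul car fin Pi_def intro!: finsum_closed\<close>)
  have one_closed: "\<one>\<^bsub>?F\<^esub> \<in> carrier ?F"
    by (rule carI[of _ "{[]}"]) (auto simp: one split: if_splits)
  have zero_closed: "\<zero>\<^bsub>?F\<^esub> \<in> carrier ?F"
    by (rule carI[of _ "{}"]) (auto simp: zero)
  have assoc: "(f \<otimes>\<^bsub>?F\<^esub> g) \<otimes>\<^bsub>?F\<^esub> h = f \<otimes>\<^bsub>?F\<^esub> (g \<otimes>\<^bsub>?F\<^esub> h)"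
    if fgh: "f \<in> carrier ?F" "g \<in> carrier ?F" "h \<in> carrier ?F" for f g h
  proof
    fix w
    let ?T = "\<lambda>i j. f (take j w) \<otimes> g (drop j (take i w)) \<otimes> h (drop i w)"
    have "((f \<otimes>\<^bsub>?F\<^esub> g) \<otimes>\<^bsub>?F\<^esub> h) w = (\<Oplus>i\<in>{..length w}. \<Oplus>j\<in>{..i}. ?T i j)"
      unfolding mul[of "f \<otimes>\<^bsub>?F\<^esub> g"]
    proof (intro finsum_cong')
      fix i assume "i \<in> {..length w}"
      then have "(f \<otimes>\<^bsub>?F\<^esub> g) (take i w) = (\<Oplus>j\<in>{..i}. f (take j w) \<otimes> g (drop j (take i w)))"
        unfolding mul by (intro finsum_cong') (auto simp: car fgh min_def Pi_def)
      then show "(f \<otimes>\<^bsub>?F\<^esub> g) (take i w) \<otimes> h (drop i w) = (\<Oplus>j\<in>{..i}. ?T i j)"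
        by (simp add: finsum_ldistr car fgh Pi_def)
    qed (auto simp: car fgh Pi_def)
    also have "\<dots> = (\<Oplus>j\<in>{..length w}. \<Oplus>i\<in>{..length w - j}. ?T (j + i) j)"
      by (rule finsum_triangle) (simp add: car fgh)
    also have "\<dots> = (f \<otimes>\<^bsub>?F\<^esub> (g \<otimes>\<^bsub>?F\<^esub> h)) w"
      unfolding mul[of f]
    proof (intro finsum_cong')
      fix j assume j: "j \<in> {..length w}"
      have "f (take j w) \<otimes> (g \<otimes>\<^bsub>?F\<^esub> h) (drop j w)
          = (\<Oplus>i\<in>{..length w - j}. f (take j w) \<otimes> (g (take i (drop j w)) \<otimes> h (drop i (drop j w))))"
        by (simp add: mul finsum_rdistr car fgh Pi_def)
      also have "\<dots> = (\<Oplus>i\<in>{..length w - j}. ?T (j + i) j)"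
        by (intro finsum_cong') (auto simp: car fgh Pi_def m_assoc drop_take add.commute)
      finally show "(\<Oplus>i\<in>{..length w - j}. ?T (j + i) j) = f (take j w) \<otimes> (g \<otimes>\<^bsub>?F\<^esub> h) (drop j w)"
        by simp
    qed (auto simp: car fgh mul_closed Pi_def)
    finally show "((f \<otimes>\<^bsub>?F\<^esub> g) \<otimes>\<^bsub>?F\<^esub> h) w = (f \<otimes>\<^bsub>?F\<^esub> (g \<otimes>\<^bsub>?F\<^esub> h)) w" .
  qed
  have l_one: "\<one>\<^bsub>?F\<^esub> \<otimes>\<^bsub>?F\<^esub> f = f" if f: "f \<in> carrier ?F" for f
  proof
    fix w
    have "(\<one>\<^bsub>?F\<^esub> \<otimes>\<^bsub>?F\<^esub> f) w = (\<Oplus>i\<in>{..length w}. if 0 = i then f w else \<zero>)"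
      unfolding mul by (intro finsum_cong') (auto simp: one car f Pi_def)
    also have "\<dots> = f w"
      by (rule finsum_singleton) (auto simp: car f)
    finally show "(\<one>\<^bsub>?F\<^esub> \<otimes>\<^bsub>?F\<^esub> f) w = f w" .
  qed
  have r_one: "f \<otimes>\<^bsub>?F\<^esub> \<one>\<^bsub>?F\<^esub> = f" if f: "f \<in> carrier ?F" for f
  proof
    fix w
    have "(f \<otimes>\<^bsub>?F\<^esub> \<one>\<^bsub>?F\<^esub>) w = (\<Oplus>i\<in>{..length w}. if length w = i then f w else \<zero>)"
      unfolding mul by (intro finsum_cong') (auto simp: one car f Pi_def)
    also have "\<dots> = f w"
      by (rule finsum_singleton) (auto simp: car f)
    finally show "(f \<otimes>\<^bsub>?F\<^esub> \<one>\<^bsub>?F\<^esub>) w = f w" .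
  qed
  show ?thesis
  proof (rule ringI)
    show "abelian_group ?F"
    proof (rule abelian_groupI)
      fix f assume f: "f \<in> carrier ?F"
      show "\<exists>g\<in>carrier ?F. g \<oplus>\<^bsub>?F\<^esub> f = \<zero>\<^bsub>?F\<^esub>"
      proof
        show "(\<lambda>w. \<ominus> f w) \<in> carrier ?F"
          by (rule carI[of _ "{w. f w \<noteq> \<zero>}"]) (use supp[OF f] in \<open>auto simp: car[OF f] fin[OF f]\<close>)
        show "(\<lambda>w. \<ominus> f w) \<oplus>\<^bsub>?F\<^esub> f = \<zero>\<^bsub>?F\<^esub>"
          by (rule ext) (simp add: add zero car[OF f] l_neg)
      qed
    qed (auto simp: add_closed zero_closed add zero car a_ac intro!: ext)
    show "Group.monoid ?F"
      by (rule monoidI) (auto simp: mul_closed one_closed assoc l_one r_one)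
    fix f g h assume fgh: "f \<in> carrier ?F" "g \<in> carrier ?F" "h \<in> carrier ?F"
    show "(f \<oplus>\<^bsub>?F\<^esub> g) \<otimes>\<^bsub>?F\<^esub> h = f \<otimes>\<^bsub>?F\<^esub> h \<oplus>\<^bsub>?F\<^esub> g \<otimes>\<^bsub>?F\<^esub> h"
      by (rule ext) (simp add: mul add car fgh l_distr finsum_addf Pi_def)
    show "h \<otimes>\<^bsub>?F\<^esub> (f \<oplus>\<^bsub>?F\<^esub> g) = h \<otimes>\<^bsub>?F\<^esub> f \<oplus>\<^bsub>?F\<^esub> h \<otimes>\<^bsub>?F\<^esub> g"
      by (rule ext) (simp add: mul add car fgh r_distr finsum_addf Pi_def)
  qed
qed

lemma free_var_closed:
  assumes "cring R" "1 \<le> i" "i \<le> m"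
  shows "free_var R i \<in> carrier (free_algebra R m)"
proof -
  interpret cring R by fact
  have "finite {w. free_var R i w \<noteq> \<zero>\<^bsub>R\<^esub>}"
    by (rule finite_subset[of _ "{[i]}"]) (auto simp: free_var_def)
  then show ?thesis
    using assms by (auto simp: free_algebra_def free_var_def split: if_splits)
qed

lemma ideal_grassmann_relations:
  assumes "cring R"
  shows "ideal (Idl\<^bsub>free_algebra R m\<^esub> (grassmann_relations R m)) (free_algebra R m)"
proof -
  interpret F: ring "free_algebra R m" by (rule ring_free_algebra) fact
  show ?thesis
    by (rule F.genideal_ideal)
      (auto simp: grassmann_relations_def Let_def intro!: F.m_closed F.a_closed free_var_closed[OF assms])
qed

lemma ring_grassmann_algebra:
  assumes "cring R"
  shows "ring (grassmann_algebra R m)"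
  unfolding grassmann_algebra_def
  by (rule ideal.quotient_is_ring[OF ideal_grassmann_relations[OF assms]])

lemma ring_matrix_ring:
  fixes A (structure)
  assumes "ring A"
  shows "ring (matrix_ring n A)"
proof -
  interpret ring A by fact
  let ?M = "matrix_ring n A"
  have carD: "M \<in> carrier_mat n n" if "M \<in> carrier ?M" for M
    using that by (auto simp: matrix_ring_def)
  have ent: "M $$ (i, j) \<in> carrier A" if "M \<in> carrier ?M" "i < n" "j < n" for M i j
    using that by (auto simp: matrix_ring_def)
  have carI: "mat n n f \<in> carrier ?M" if "\<And>i j. i < n \<Longrightarrow> j < n \<Longrightarrow> f (i, j) \<in> carrier A" for f
    using that by (auto simp: matrix_ring_def)
  have mul: "M \<otimes>\<^bsub>?M\<^esub> N = mat n n (\<lambda>(i, j). \<Oplus>l\<in>{..<n}. M $$ (i, l) \<otimes> N $$ (l, j))" for M N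
    by (simp add: matrix_ring_def)
  have add: "M \<oplus>\<^bsub>?M\<^esub> N = mat n n (\<lambda>ij. M $$ ij \<oplus> N $$ ij)" for M N
    by (simp add: matrix_ring_def)
  have one: "\<one>\<^bsub>?M\<^esub> = mat n n (\<lambda>(i, j). if i = j then \<one> else \<zero>)"
    by (simp add: matrix_ring_def)
  have zero: "\<zero>\<^bsub>?M\<^esub> = mat n n (\<lambda>_. \<zero>)"
    by (simp add: matrix_ring_def)
  have eqI: "M = N" if "M \<in> carrier_mat n n" "N \<in> carrier_mat n n"
    "\<And>i j. i < n \<Longrightarrow> j < n \<Longrightarrow> M $$ (i, j) = N $$ (i, j)" for M N :: "'a mat"
    using that by (intro eq_matI) auto
  have add_closed: "M \<oplus>\<^bsub>?M\<^esub> N \<in> carrier ?M" if "M \<in> carrier ?M" "N \<in> carrier ?M" for M N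
    unfolding add by (rule carI) (simp add: ent that)
  have mul_closed: "M \<otimes>\<^bsub>?M\<^esub> N \<in> carrier ?M" if "M \<in> carrier ?M" "N \<in> carrier ?M" for M N
    unfolding mul by (rule carI) (auto simp: ent that intro!: finsum_closed)
  show ?thesis
  proof (rule ringI)
    show "abelian_group ?M"
    proof (rule abelian_groupI)
      fix M assume M: "M \<in> carrier ?M"
      show "\<exists>N\<in>carrier ?M. N \<oplus>\<^bsub>?M\<^esub> M = \<zero>\<^bsub>?M\<^esub>"
      proof
        show "mat n n (\<lambda>ij. \<ominus> M $$ ij) \<in> carrier ?M"
          by (rule carI) (simp add: ent[OF M])
        show "mat n n (\<lambda>ij. \<ominus> M $$ ij) \<oplus>\<^bsub>?M\<^esub> M = \<zero>\<^bsub>?M\<^esub>"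
          by (rule eqI) (auto simp: add zero ent[OF M] l_neg)
      qed
    next
      fix M assume "M \<in> carrier ?M"
      then show "\<zero>\<^bsub>?M\<^esub> \<oplus>\<^bsub>?M\<^esub> M = M"
        by (intro eqI) (auto simp: add zero ent carD)
    next
      show "\<zero>\<^bsub>?M\<^esub> \<in> carrier ?M" unfolding zero by (rule carI) simp
    next
      fix M N P assume "M \<in> carrier ?M" "N \<in> carrier ?M" "P \<in> carrier ?M"
      then show "M \<oplus>\<^bsub>?M\<^esub> N \<oplus>\<^bsub>?M\<^esub> P = M \<oplus>\<^bsub>?M\<^esub> (N \<oplus>\<^bsub>?M\<^esub> P)"
        by (intro eqI) (auto simp: add ent a_assoc)
    next
      fix M N assume "M \<in> carrier ?M" "N \<in> carrier ?M"
      then show "M \<oplus>\<^bsub>?M\<^esub> N = N \<oplus>\<^bsub>?M\<^esub> M"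
        by (intro eqI) (auto simp: add ent a_comm)
    qed (rule add_closed)
    show "Group.monoid ?M"
    proof (rule monoidI)
      show "\<one>\<^bsub>?M\<^esub> \<in> carrier ?M" unfolding one by (rule carI) simp
    next
      fix M assume M: "M \<in> carrier ?M"
      show "\<one>\<^bsub>?M\<^esub> \<otimes>\<^bsub>?M\<^esub> M = M"
      proof (rule eqI)
        fix i j assume ij: "i < n" "j < n"
        have "(\<one>\<^bsub>?M\<^esub> \<otimes>\<^bsub>?M\<^esub> M) $$ (i, j) = (\<Oplus>l\<in>{..<n}. if i = l then M $$ (l, j) else \<zero>)"
          unfolding mul using ij by (auto simp: one ent[OF M] intro!: finsum_cong')
        also have "\<dots> = M $$ (i, j)"
          using ij by (intro finsum_singleton) (auto simp: ent[OF M])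
        finally show "(\<one>\<^bsub>?M\<^esub> \<otimes>\<^bsub>?M\<^esub> M) $$ (i, j) = M $$ (i, j)" .
      qed (auto simp: mul carD[OF M])
      show "M \<otimes>\<^bsub>?M\<^esub> \<one>\<^bsub>?M\<^esub> = M"
      proof (rule eqI)
        fix i j assume ij: "i < n" "j < n"
        have "(M \<otimes>\<^bsub>?M\<^esub> \<one>\<^bsub>?M\<^esub>) $$ (i, j) = (\<Oplus>l\<in>{..<n}. if j = l then M $$ (i, l) else \<zero>)"
          unfolding mul using ij by (auto simp: one ent[OF M] intro!: finsum_cong')
        also have "\<dots> = M $$ (i, j)"
          using ij by (intro finsum_singleton) (auto simp: ent[OF M])
        finally show "(M \<otimes>\<^bsub>?M\<^esub> \<one>\<^bsub>?M\<^esub>) $$ (i, j) = M $$ (i, j)" .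
      qed (auto simp: mul carD[OF M])
    next
      fix M N P assume MNP: "M \<in> carrier ?M" "N \<in> carrier ?M" "P \<in> carrier ?M"
      show "M \<otimes>\<^bsub>?M\<^esub> N \<otimes>\<^bsub>?M\<^esub> P = M \<otimes>\<^bsub>?M\<^esub> (N \<otimes>\<^bsub>?M\<^esub> P)"
      proof (rule eqI)
        fix i j assume ij: "i < n" "j < n"
        let ?T = "\<lambda>l k. M $$ (i, k) \<otimes> N $$ (k, l) \<otimes> P $$ (l, j)"
        have "(M \<otimes>\<^bsub>?M\<^esub> N \<otimes>\<^bsub>?M\<^esub> P) $$ (i, j) = (\<Oplus>l\<in>{..<n}. \<Oplus>k\<in>{..<n}. ?T l k)"
          unfolding mul using ij
          by (auto simp: ent MNP finsum_ldistr Pi_def intro!: finsum_cong')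
        also have "\<dots> = (\<Oplus>k\<in>{..<n}. \<Oplus>l\<in>{..<n}. ?T l k)"
          using ij by (intro finsum_exchange) (auto simp: ent MNP)
        also have "\<dots> = (M \<otimes>\<^bsub>?M\<^esub> (N \<otimes>\<^bsub>?M\<^esub> P)) $$ (i, j)"
          unfolding mul using ij
          by (auto simp: ent MNP finsum_rdistr Pi_def m_assoc intro!: finsum_cong')
        finally show "(M \<otimes>\<^bsub>?M\<^esub> N \<otimes>\<^bsub>?M\<^esub> P) $$ (i, j) = (M \<otimes>\<^bsub>?M\<^esub> (N \<otimes>\<^bsub>?M\<^esub> P)) $$ (i, j)" .
      qed (auto simp: mul)
    qed (rule mul_closed)
    fix M N P assume MNP: "M \<in> carrier ?M" "N \<in> carrier ?M" "P \<in> carrier ?M"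
    show "(M \<oplus>\<^bsub>?M\<^esub> N) \<otimes>\<^bsub>?M\<^esub> P = M \<otimes>\<^bsub>?M\<^esub> P \<oplus>\<^bsub>?M\<^esub> N \<otimes>\<^bsub>?M\<^esub> P"
    proof (rule eqI)
      fix i j assume ij: "i < n" "j < n"
      have "((M \<oplus>\<^bsub>?M\<^esub> N) \<otimes>\<^bsub>?M\<^esub> P) $$ (i, j) = (\<Oplus>l\<in>{..<n}. M $$ (i, l) \<otimes> P $$ (l, j) \<oplus> N $$ (i, l) \<otimes> P $$ (l, j))"
        unfolding mul add using ij by (auto simp: ent MNP l_distr simp del: finsum_addf intro!: finsum_cong')
      also have "\<dots> = (\<Oplus>l\<in>{..<n}. M $$ (i, l) \<otimes> P $$ (l, j)) \<oplus> (\<Oplus>l\<in>{..<n}. N $$ (i, l) \<otimes> P $$ (l, j))"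
        using ij by (intro finsum_addf) (auto simp: ent MNP)
      finally show "((M \<oplus>\<^bsub>?M\<^esub> N) \<otimes>\<^bsub>?M\<^esub> P) $$ (i, j) = (M \<otimes>\<^bsub>?M\<^esub> P \<oplus>\<^bsub>?M\<^esub> N \<otimes>\<^bsub>?M\<^esub> P) $$ (i, j)"
        using ij by (simp add: mul add)
    qed (auto simp: mul add)
    show "P \<otimes>\<^bsub>?M\<^esub> (M \<oplus>\<^bsub>?M\<^esub> N) = P \<otimes>\<^bsub>?M\<^esub> M \<oplus>\<^bsub>?M\<^esub> P \<otimes>\<^bsub>?M\<^esub> N"
    proof (rule eqI)
      fix i j assume ij: "i < n" "j < n"
      have "(P \<otimes>\<^bsub>?M\<^esub> (M \<oplus>\<^bsub>?M\<^esub> N)) $$ (i, j) = (\<Oplus>l\<in>{..<n}. P $$ (i, l) \<otimes> M $$ (l, j) \<oplus> P $$ (i, l) \<otimes> N $$ (l, j))"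
        unfolding mul add using ij by (auto simp: ent MNP r_distr simp del: finsum_addf intro!: finsum_cong')
      also have "\<dots> = (\<Oplus>l\<in>{..<n}. P $$ (i, l) \<otimes> M $$ (l, j)) \<oplus> (\<Oplus>l\<in>{..<n}. P $$ (i, l) \<otimes> N $$ (l, j))"
        using ij by (intro finsum_addf) (auto simp: ent MNP)
      finally show "(P \<otimes>\<^bsub>?M\<^esub> (M \<oplus>\<^bsub>?M\<^esub> N)) $$ (i, j) = (P \<otimes>\<^bsub>?M\<^esub> M \<oplus>\<^bsub>?M\<^esub> P \<otimes>\<^bsub>?M\<^esub> N) $$ (i, j)"
        using ij by (simp add: mul add)
    qed (auto simp: mul add)
  qed
qed

end

theory Submission
  imports Defs "HOL-Combinatorics.Cycles"
begin

text \<open>Elements of degree at least 2 form an ideal \<open>J\<close> of the free algebra with commutative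
  quotient. By the Amitsur--Levitzki theorem for this quotient, \<open>s\<^bsub>2n\<^esub>\<close> of matrices over the free
  algebra has entries in \<open>J\<close>. Laplace expansion writes \<open>s\<^bsub>2nq\<^esub>\<close> as a signed sum of products of \<open>q\<close>
  values of \<open>s\<^bsub>2n\<^esub>\<close>, whose entries have degree at least \<open>2q\<close>; for \<open>q = \<lfloor>m/2\<rfloor> + 1\<close> this exceeds \<open>m\<close>,
  and every word longer than \<open>m\<close> repeats a letter, hence vanishes in \<open>E\<^sup>m\<close>.

  The Amitsur--Levitzki theorem is multilinear in the matrices, so over any commutative ring it
  follows from the case of matrix units, that is, from the integers. There it comes from
  the fundamental trace identity (Razmyslov): the signed sum over \<open>\<rho> \<in> S\<^bsub>n+1\<^esub>\<close> of
  the products of traces along the cycles of \<open>\<rho>\<close> vanishes for \<open>n \<times> n\<close> matrices. Apply it to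
  \<open>X\<^sub>1X\<^sub>2, \<dots>, X\<^bsub>2n-1\<^esub>X\<^bsub>2n\<^esub>, Y\<close> and antisymmetrize in the \<open>X\<^sub>i\<close>. A cycle without \<open>Y\<close> is a trace
  of an even number of the \<open>X\<^sub>i\<close>, which a cyclic rotation of odd sign preserves, so such terms
  cancel; the \<open>n!\<close> full cycles all give \<open>\<plusminus>tr (s\<^bsub>2n\<^esub>(X) Y)\<close> with the same sign.\<close>

section \<open>The Amitsur--Levitzki theorem over the integers\<close>

lemma sign_cycle_of_list:
  assumes "distinct cs" "cs \<noteq> []"
  shows "sign (cycle_of_list cs) = (- 1) ^ (length cs - 1)"
  using assms
proof (induction cs rule: cycle_of_list.induct)
  case (1 i j cs)
  then show ?case
    by (simp only: cycle_of_list.simps sign_compose permutation_swap_id permutation_of_cycle)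
      (auto simp: sign_swap_id)
qed auto

text \<open>On the orbit of \<open>a\<close> the cycle acts as \<open>p\<close>, off it as the
  identity, and \<open>p\<close> preserves both the orbit and its complement. So a cycle of
  \<open>p\<close> is a symmetry of \<open>p\<close>, which is what conjugation arguments
  need.\<close>

lemma cycle_of_support_commute:
  assumes "permutation p"
  shows "cycle_of_list (support p a) \<circ> p = p \<circ> cycle_of_list (support p a)"
proof
  fix x
  let ?C = "set (support p a)" and ?c = "cycle_of_list (support p a)"
  have C: "?C = range (\<lambda>i. (p ^^ i) a)"
    by (rule support_set[OF assms])
  have closed: "p x \<in> ?C \<longleftrightarrow> x \<in> ?C"
  proof
    assume "x \<in> ?C"
    then obtain i where "x = (p ^^ i) a" unfolding C by blast
    then have "p x = (p ^^ Suc i) a" by simp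
    then show "p x \<in> ?C" unfolding C by blast
  next
    assume "p x \<in> ?C"
    then obtain i where i: "p x = (p ^^ i) a" unfolding C by blast
    \<comment> \<open>A power equal to the identity turns the inverse of \<open>p\<close> into
      \<open>p ^^ (m - 1)\<close>, so the forward orbit is also closed under going
      backwards.\<close>
    obtain m where m: "p ^^ m = id" "m > 1"
      using permutation_is_nilpotent'[OF assms] .
    have "x = (p ^^ (m - 1 + 1)) x" using m by simp
    also have "\<dots> = (p ^^ (m - 1)) (p x)" by (simp only: funpow_add) simp
    also have "\<dots> = (p ^^ (m - 1 + i)) a" by (simp add: i funpow_add)
    finally show "x \<in> ?C" unfolding C by blast
  qed
  show "(?c \<circ> p) x = (p \<circ> ?c) x"
  proof (cases "x \<in> ?C")
    case True
    then show ?thesis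
      using cycle_restrict[OF assms, of x a] cycle_restrict[OF assms, of "p x" a] closed by simp
  next
    case False
    then show ?thesis using closed id_outside_supp by (metis comp_apply)
  qed
qed

section \<open>Products of traces as sums over index maps\<close>

lemma bij_betw_restrict_comp:
  assumes "\<kappa> permutes S"
  shows "bij_betw (\<lambda>h. restrict (h \<circ> \<kappa>) S) (S \<rightarrow>\<^sub>E T) (S \<rightarrow>\<^sub>E T)"
proof (rule bij_betwI[of _ _ _ "\<lambda>h. restrict (h \<circ> inv_into UNIV \<kappa>) S"])
  have inv: "inv_into UNIV \<kappa> permutes S" using assms by (rule permutes_inv)
  show "(\<lambda>h. restrict (h \<circ> \<kappa>) S) \<in> (S \<rightarrow>\<^sub>E T) \<rightarrow> (S \<rightarrow>\<^sub>E T)"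
    by (auto simp: permutes_in_image[OF assms])
  show "(\<lambda>h. restrict (h \<circ> inv_into UNIV \<kappa>) S) \<in> (S \<rightarrow>\<^sub>E T) \<rightarrow> (S \<rightarrow>\<^sub>E T)"
    by (auto simp: permutes_in_image[OF inv])
  show "restrict (restrict (h \<circ> \<kappa>) S \<circ> inv_into UNIV \<kappa>) S = h" if "h \<in> S \<rightarrow>\<^sub>E T" for h
    using that by (auto simp: fun_eq_iff restrict_def permutes_in_image[OF inv] permutes_inverses[OF assms] PiE_def extensional_def)
  show "restrict (restrict (h \<circ> inv_into UNIV \<kappa>) S \<circ> \<kappa>) S = h" if "h \<in> S \<rightarrow>\<^sub>E T" for h
    using that by (auto simp: fun_eq_iff restrict_def permutes_in_image[OF assms] permutes_inverses[OF assms] PiE_def extensional_def)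
qed

text \<open>Summing over all index maps \<open>h\<close> gives the product, over the cycles of \<open>\<rho>\<close>, of the trace of
  the product of the matrices \<open>W j\<close> along the cycle.\<close>

definition walk_sum :: "'i set \<Rightarrow> nat \<Rightarrow> ('i \<Rightarrow> nat \<Rightarrow> nat \<Rightarrow> int) \<Rightarrow> ('i \<Rightarrow> 'i) \<Rightarrow> int" where
  "walk_sum S n W \<rho> = (\<Sum>h\<in>S \<rightarrow>\<^sub>E {..<n}. \<Prod>j\<in>S. W j (h j) (h (\<rho> j)))"

text \<open>Antisymmetrization in the matrices indexed by \<open>S'\<close> only. Later
  \<open>S'\<close> is \<open>{1..2 * n}\<close> inside \<open>{0..2 * n}\<close>: the index 0
  carries the extra matrix \<open>Y\<close> and stays out of the alternation.\<close>

definition alt_walk_sum ::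
    "'i set \<Rightarrow> 'i set \<Rightarrow> nat \<Rightarrow> ('i \<Rightarrow> nat \<Rightarrow> nat \<Rightarrow> int) \<Rightarrow> ('i \<Rightarrow> 'i) \<Rightarrow> int" where
  "alt_walk_sum S S' n W \<rho> = (\<Sum>\<pi> | \<pi> permutes S'. sign \<pi> * walk_sum S n (W \<circ> \<pi>) \<rho>)"

text \<open>Conjugation by \<open>\<kappa>\<close> carries the cycles of \<open>\<rho>'\<close> to
  those of \<open>\<rho>\<close>. Relabelling the matrices along with them, by the substitution of
  \<open>h \<circ> \<kappa>\<close> for \<open>h\<close>, leaves every trace unchanged.\<close>

lemma walk_sum_conj:
  assumes \<kappa>: "\<kappa> permutes S" and \<rho>': "\<rho>' permutes S" and eq: "\<kappa> \<circ> \<rho>' = \<rho> \<circ> \<kappa>"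
  shows "walk_sum S n (W \<circ> \<kappa>) \<rho>' = walk_sum S n W \<rho>"
proof -
  have "walk_sum S n (W \<circ> \<kappa>) \<rho>'
      = (\<Sum>h\<in>S \<rightarrow>\<^sub>E {..<n}. \<Prod>j\<in>S. W (\<kappa> j) (restrict (h \<circ> \<kappa>) S j) (restrict (h \<circ> \<kappa>) S (\<rho>' j)))"
    unfolding walk_sum_def comp_def[of W]
    by (rule sum.reindex_bij_betw[OF bij_betw_restrict_comp[OF \<kappa>], symmetric])
  also have "\<dots> = (\<Sum>h\<in>S \<rightarrow>\<^sub>E {..<n}. \<Prod>j\<in>S. W (\<kappa> j) (h (\<kappa> j)) (h (\<rho> (\<kappa> j))))"
    using eq by (intro sum.cong prod.cong) (auto simp: permutes_in_image[OF \<rho>'] fun_eq_iff)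
  also have "\<dots> = walk_sum S n W \<rho>"
    unfolding walk_sum_def
    by (intro sum.cong refl prod.reindex_bij_betw[OF permutes_imp_bij[OF \<kappa>], of "\<lambda>j. W j (_ j) (_ (\<rho> j))"])
  finally show ?thesis .
qed

text \<open>Substituting \<open>\<pi> \<circ> \<kappa>\<close> for \<open>\<pi>\<close> releases the
  sign of \<open>\<kappa>\<close>, and the relabelling is absorbed by the walk sum. An odd
  \<open>\<kappa>\<close> commuting with \<open>\<rho>\<close> therefore forces cancellation, while
  an even \<open>\<kappa>\<close> identifies the terms of conjugate permutations.\<close>

lemma alt_walk_sum_conj:
  assumes "finite S" "S' \<subseteq> S" and \<kappa>: "\<kappa> permutes S'" and \<rho>': "\<rho>' permutes S" and eq: "\<kappa> \<circ> \<rho>' = \<rho> \<circ> \<kappa>"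
  shows "alt_walk_sum S S' n W \<rho>' = sign \<kappa> * alt_walk_sum S S' n W \<rho>"
proof -
  have fin: "finite S'" using assms finite_subset by blast
  have "alt_walk_sum S S' n W \<rho>' = (\<Sum>\<pi> | \<pi> permutes S'. sign (\<pi> \<circ> \<kappa>) * walk_sum S n (W \<circ> (\<pi> \<circ> \<kappa>)) \<rho>')"
    unfolding alt_walk_sum_def by (rule sum_permutations_compose_right[OF \<kappa>])
  also have "\<dots> = (\<Sum>\<pi> | \<pi> permutes S'. sign \<kappa> * (sign \<pi> * walk_sum S n (W \<circ> \<pi>) \<rho>))"
  proof (rule sum.cong[OF refl])
    fix \<pi> assume "\<pi> \<in> {\<pi>. \<pi> permutes S'}"
    then have "sign (\<pi> \<circ> \<kappa>) = sign \<pi> * sign \<kappa>"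
      using fin \<kappa> by (intro sign_compose) (auto simp: permutation_permutes)
    moreover have "walk_sum S n (W \<circ> (\<pi> \<circ> \<kappa>)) \<rho>' = walk_sum S n (W \<circ> \<pi>) \<rho>"
      using walk_sum_conj[OF permutes_subset[OF \<kappa> assms(2)] \<rho>' eq, of n "W \<circ> \<pi>"] by (simp add: o_assoc)
    ultimately show "sign (\<pi> \<circ> \<kappa>) * walk_sum S n (W \<circ> (\<pi> \<circ> \<kappa>)) \<rho>' = sign \<kappa> * (sign \<pi> * walk_sum S n (W \<circ> \<pi>) \<rho>)"
      by simp
  qed
  also have "\<dots> = sign \<kappa> * alt_walk_sum S S' n W \<rho>"
    by (simp add: alt_walk_sum_def sum_distrib_left)
  finally show ?thesis .
qed

text \<open>More than \<open>n\<close> indices are not forced to be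
  the successor of a given index, so every \<open>h\<close> takes the same value at two of them, and
  exchanging these two values of \<open>\<rho>\<close> changes only the sign.\<close>

lemma sum_sign_walk_sum_eq_0:
  assumes "finite S" and V: "V \<subseteq> S" "card V > n" "\<And>i. i \<in> D \<Longrightarrow> e i \<notin> V"
  shows "(\<Sum>\<rho> | \<rho> permutes S \<and> (\<forall>i\<in>D. \<rho> i = e i). sign \<rho> * walk_sum S n W \<rho>) = 0"
proof -
  let ?P = "{\<rho>. \<rho> permutes S \<and> (\<forall>i\<in>D. \<rho> i = e i)}"
  have "(\<Sum>\<rho>\<in>?P. sign \<rho> * (\<Prod>j\<in>S. W j (h j) (h (\<rho> j)))) = 0" if h: "h \<in> S \<rightarrow>\<^sub>E {..<n}" for h
  proof -
    have "\<not> inj_on h V"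
    proof
      assume "inj_on h V"
      then have "card V \<le> card {..<n}"
        using h V(1) by (intro card_inj_on_le[of h]) auto
      then show False using V(2) by simp
    qed
    then obtain a b where ab: "a \<in> V" "b \<in> V" "a \<noteq> b" "h a = h b"
      by (auto simp: inj_on_def)
    let ?t = "transpose a b"
    have t: "?t permutes S" using ab V(1) by (intro permutes_swap_id) auto
    have ht: "h (?t x) = h x" for x
      using ab by (auto simp: transpose_def)
    \<comment> \<open>The transposition moves only two points of \<open>V\<close>, and no prescribed
      value \<open>e i\<close> lies in \<open>V\<close>, so the constraints survive.\<close>
    have mem: "?t \<circ> \<rho> \<in> ?P" if "\<rho> \<in> ?P" for \<rho>
    proof -
      have "?t (e i) = e i" if "i \<in> D" for i
        using V(3)[OF that] ab by (auto simp: transpose_def)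
      then show ?thesis using that t by (auto intro: permutes_compose)
    qed
    let ?f = "\<lambda>\<rho>. sign \<rho> * (\<Prod>j\<in>S. W j (h j) (h (\<rho> j)))"
    have "sum ?f ?P = (\<Sum>\<rho>\<in>?P. - ?f \<rho>)"
    proof (rule sum.reindex_bij_witness[of _ "\<lambda>\<rho>. ?t \<circ> \<rho>" "\<lambda>\<rho>. ?t \<circ> \<rho>"])
      fix \<rho> assume \<rho>: "\<rho> \<in> ?P"
      have "sign (?t \<circ> \<rho>) = sign ?t * sign \<rho>"
        using \<rho> \<open>finite S\<close> by (intro sign_compose permutation_swap_id) (auto simp: permutation_permutes)
      then have "sign (?t \<circ> \<rho>) = - sign \<rho>" by (simp add: sign_swap_id ab)
      then show "- ?f (?t \<circ> \<rho>) = ?f \<rho>" by (simp add: ht)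
    qed (use mem in \<open>auto simp: o_assoc\<close>)
    then show ?thesis by (simp add: sum_negf)
  qed
  then have "(\<Sum>h\<in>S \<rightarrow>\<^sub>E {..<n}. \<Sum>\<rho>\<in>?P. sign \<rho> * (\<Prod>j\<in>S. W j (h j) (h (\<rho> j)))) = 0"
    by simp
  then show ?thesis
    unfolding walk_sum_def sum_distrib_left by (subst sum.swap)
qed

section \<open>Permutations respecting the pairing of \<open>2i - 1\<close> with
  \<open>2i\<close>\<close>

lemma inj_on_imp_permutes:
  assumes "finite S" "inj_on f S" "f ` S \<subseteq> S" "\<And>x. x \<notin> S \<Longrightarrow> f x = x"
  shows "f permutes S"
  using assms by (intro bij_imp_permutes) (auto simp: bij_betw_def endo_inj_surj)

text \<open>Such a permutation is the product of two conjugate permutations, one of the odd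
  numbers and one of the even ones.\<close>

lemma sign_pairwise_permutation:
  assumes \<tau>: "\<tau> permutes {1..2 * n}"
    and odd: "\<And>j. odd j \<Longrightarrow> j \<in> {1..2 * n} \<Longrightarrow> odd (\<tau> j)"
    and Suc: "\<And>j. odd j \<Longrightarrow> j \<in> {1..2 * n} \<Longrightarrow> \<tau> (Suc j) = Suc (\<tau> j)"
  shows "sign \<tau> = 1"
proof -
  let ?S = "{1..2 * n}"
  \<comment> \<open>\<open>s\<close> exchanges the two members of each pair, and
    \<open>\<tau>'\<close> is the part of \<open>\<tau>\<close> that acts on the odd
    numbers.\<close>
  define s where "s j = (if j \<in> ?S then if odd j then Suc j else j - 1 else j)" for j
  define \<tau>' where "\<tau>' j = (if odd j then \<tau> j else j)" for j
  have s_mem: "s j \<in> ?S" if "j \<in> ?S" for j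
    using that by (auto simp: s_def) presburger
  have ss: "s (s j) = j" for j
    by (auto simp: s_def) presburger
  have s_odd: "odd (s j) \<longleftrightarrow> even j" if "j \<in> ?S" for j
    using that by (auto simp: s_def)
  have s: "s permutes ?S"
  proof (rule inj_on_imp_permutes)
    show "inj_on s ?S" by (rule inj_on_inverseI[of _ s]) (rule ss)
    show "s ` ?S \<subseteq> ?S" by (rule image_subsetI) (rule s_mem)
  qed (auto simp: s_def)
  have mem: "\<tau> j \<in> ?S \<longleftrightarrow> j \<in> ?S" for j by (rule permutes_in_image[OF \<tau>])
  have inj: "\<tau> i = \<tau> j \<longleftrightarrow> i = j" for i j using permutes_inj[OF \<tau>] by (auto simp: inj_def)
  have \<tau>': "\<tau>' permutes ?S"
  proof (rule inj_on_imp_permutes)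
    show "inj_on \<tau>' ?S"
    proof (rule inj_onI)
      fix i j assume ij: "i \<in> ?S" "j \<in> ?S" "\<tau>' i = \<tau>' j"
      then show "i = j" using odd[of i] odd[of j] inj by (auto simp: \<tau>'_def split: if_splits)
    qed
    show "\<tau>' ` ?S \<subseteq> ?S"
      by (rule image_subsetI) (simp only: \<tau>'_def mem split: if_split, simp)
    show "\<tau>' x = x" if "x \<notin> ?S" for x
      using that permutes_not_in[OF \<tau>] by (auto simp: \<tau>'_def)
  qed simp
  \<comment> \<open>Conjugating \<open>\<tau>'\<close> by \<open>s\<close> gives the action of
    \<open>\<tau>\<close> on the even numbers. Each of \<open>s\<close> and \<open>\<tau>'\<close>
    occurs twice, so the signs multiply to 1.\<close>
  have "\<tau> = \<tau>' \<circ> (s \<circ> (\<tau>' \<circ> s))"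
  proof
    fix j
    show "\<tau> j = (\<tau>' \<circ> (s \<circ> (\<tau>' \<circ> s))) j"
    proof (cases "j \<in> ?S")
      case False
      then have "\<tau> j = j" "s j = j" using permutes_not_in[OF \<tau>] by (auto simp: s_def)
      then show ?thesis by (simp add: \<tau>'_def)
    next
      case True
      show ?thesis
      proof (cases "odd j")
        case True
        then have "\<not> odd (s j)" using s_odd \<open>j \<in> ?S\<close> by blast
        then have "s (\<tau>' (s j)) = j" by (simp add: \<tau>'_def ss)
        with True show ?thesis by (simp add: \<tau>'_def)
      next
        case False
        then have j: "s j = j - 1" "odd (j - 1)" "j - 1 \<in> ?S" "Suc (j - 1) = j"
          using True by (auto simp: s_def elim!: evenE)
        have "odd (\<tau> (j - 1))" "\<tau> (j - 1) \<in> ?S" "\<tau> j = Suc (\<tau> (j - 1))"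
          using odd[of "j - 1"] Suc[of "j - 1"] mem[of "j - 1"] j by auto
        then have "s (\<tau>' (s j)) = \<tau> j" "even (\<tau> j)"
          using j by (simp_all add: \<tau>'_def s_def)
        then show ?thesis by (simp add: \<tau>'_def)
      qed
    qed
  qed
  moreover have "permutation s" "permutation \<tau>'"
    using s \<tau>' by (auto simp: permutation_permutes)
  ultimately have "sign \<tau> = sign \<tau>' * (sign s * (sign \<tau>' * sign s))"
    by (simp add: sign_compose permutation_compose)
  then show ?thesis by (simp add: mult.left_commute)
qed

text \<open>The reference full cycle: its walk sum is the trace of the product of
  \<open>W 0\<close>, \<open>W 1\<close>, ..., \<open>W N\<close> in this order.\<close>

definition rot :: "nat \<Rightarrow> nat \<Rightarrow> nat" where
  "rot N j = (if j < N then Suc j else if j = N then 0 else j)"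

lemma rot_permutes: "rot N permutes {0..N}"
  by (rule inj_on_imp_permutes) (auto simp: rot_def inj_on_def)

lemma funpow_rot: "j \<le> N \<Longrightarrow> (rot N ^^ j) 0 = j"
  by (induction j) (auto simp: rot_def)

text \<open>In the trace identity applied to \<open>X\<^sub>1X\<^sub>2, X\<^sub>3X\<^sub>4, \<dots>, X\<^bsub>2n-1\<^esub>X\<^bsub>2n\<^esub>\<close> and \<open>X\<^sub>0\<close>, the permutation of
  all \<open>2n + 1\<close> factors sends each odd index to the next even one.\<close>

locale paired_permutation =
  fixes n :: nat and \<rho> :: "nat \<Rightarrow> nat"
  assumes permutes: "\<rho> permutes {0..2 * n}"
    and odd: "\<And>j. j \<in> {0..2 * n} \<Longrightarrow> odd j \<Longrightarrow> \<rho> j = Suc j"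
begin

lemma permutation: "permutation \<rho>"
  using permutes by (auto simp: permutation_permutes)

lemma funpow_mem: "j \<in> {0..2 * n} \<Longrightarrow> (\<rho> ^^ i) j \<in> {0..2 * n}"
  using permutes_in_image[OF permutes_funpow[OF permutes]] by blast

text \<open>A nonzero even value is already taken at its odd predecessor. By injectivity an even
  \<open>j\<close> can then only go to 0 or to an odd number.\<close>

lemma even_step:
  assumes j: "j \<in> {0..2 * n}" and nz: "\<rho> j \<noteq> 0"
  shows "even (\<rho> j) \<longleftrightarrow> odd j"
proof (cases "odd j")
  case False
  have "odd (\<rho> j)"
  proof (rule ccontr)
    assume ev: "\<not> odd (\<rho> j)"
    have "\<rho> j \<in> {0..2 * n}" using permutes_in_image[OF permutes] j by blast
    then have "\<rho> (\<rho> j - 1) = \<rho> j"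
      using nz ev odd[of "\<rho> j - 1"] by auto
    then have "\<rho> j - 1 = j" using permutes_inj[OF permutes] by (simp add: inj_eq)
    then have "odd (\<rho> j)" using False nz by (metis Suc_pred even_Suc neq0_conv One_nat_def)
    with ev show False by simp
  qed
  with False show ?thesis by simp
qed (use odd j in auto)

text \<open>Used twice: a closed orbit avoiding 0 must have even length, and a full cycle started at
  0 meets odd numbers exactly at odd times.\<close>

lemma even_funpow:
  assumes "j \<in> {0..2 * n}" "\<And>k. 0 < k \<Longrightarrow> k \<le> i \<Longrightarrow> (\<rho> ^^ k) j \<noteq> 0"
  shows "even ((\<rho> ^^ i) j) \<longleftrightarrow> (even i \<longleftrightarrow> even j)"
  using assms(2)
proof (induction i)
  case (Suc i)
  have "even ((\<rho> ^^ Suc i) j) \<longleftrightarrow> odd ((\<rho> ^^ i) j)"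
    using even_step[OF funpow_mem[OF assms(1), of i]] Suc.prems[of "Suc i"] by simp
  also have "\<dots> \<longleftrightarrow> \<not> (even i \<longleftrightarrow> even j)" using Suc by simp
  finally show ?case by auto
qed simp

text \<open>A cycle avoiding 0 has even length, so rotating it changes the sign of the arguments
  but not the trace.\<close>

lemma alt_walk_sum_eq_0:
  assumes j: "j \<in> {0..2 * n}" "j \<notin> range (\<lambda>i. (\<rho> ^^ i) 0)"
  shows "alt_walk_sum {0..2 * n} {1..2 * n} d W \<rho> = 0"
proof -
  \<comment> \<open>An orbit of \<open>j\<close> reaching 0 would, continued around the cycle, lead
    from 0 back to \<open>j\<close>.\<close>
  have nz: "(\<rho> ^^ i) j \<noteq> 0" for i
  proof
    assume 0: "(\<rho> ^^ i) j = 0"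
    obtain m where m: "\<rho> ^^ m = id" "m > i"
      using permutation_is_nilpotent'[OF permutation] .
    then have "(\<rho> ^^ (m - i)) 0 = j"
      using fun_cong[OF funpow_add[of "m - i" i \<rho>], of j] 0 by simp
    then show False using j(2) by blast
  qed
  let ?cs = "support \<rho> j" and ?l = "least_power \<rho> j"
  let ?\<kappa> = "cycle_of_list ?cs"
  have l: "(\<rho> ^^ ?l) j = j" "?l > 0"
    using least_power_of_permutation[OF permutation] by auto
  have "even ?l" using even_funpow[OF j(1), of ?l] nz l(1) by auto
  then have "sign ?\<kappa> = - 1"
    using sign_cycle_of_list[OF cycle_of_permutation[OF permutation], of j] l(2) by simp
  moreover have "?\<kappa> permutes {1..2 * n}"
  proof (rule permutes_subset[OF cycle_permutes])
    show "set ?cs \<subseteq> {1..2 * n}"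
      using nz funpow_mem[OF j(1)] by (auto simp: Suc_le_eq)
  qed
  \<comment> \<open>The cycle commutes with \<open>\<rho>\<close>, so conjugation sends
    \<open>\<rho>\<close> to itself and the alternating sum equals its own negative. In the integers
    this makes it 0.\<close>
  ultimately have "alt_walk_sum {0..2 * n} {1..2 * n} d W \<rho> = - alt_walk_sum {0..2 * n} {1..2 * n} d W \<rho>"
    using alt_walk_sum_conj[OF _ _ _ permutes cycle_of_support_commute[OF permutation], of "{1..2 * n}" j d W]
    by auto
  then show ?thesis by simp
qed

text \<open>\<open>\<tau>\<close> sends \<open>j\<close> to the point reached from 0 after
  \<open>j\<close> steps, which conjugates \<open>rot\<close> to \<open>\<rho>\<close>. Parities
  alternate along the orbit and \<open>\<rho>\<close> sends odd \<open>j\<close> to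
  \<open>Suc j\<close>, so \<open>\<tau>\<close> maps pairs to pairs and is even.\<close>

lemma full_cycle_conj:
  assumes full: "{0..2 * n} \<subseteq> range (\<lambda>i. (\<rho> ^^ i) 0)"
  obtains \<tau> where "\<tau> permutes {1..2 * n}" "sign \<tau> = 1" "\<tau> \<circ> rot (2 * n) = \<rho> \<circ> \<tau>"
proof -
  let ?S = "{0..2 * n}" and ?l = "least_power \<rho> 0"
  define \<tau> where "\<tau> j = (if j \<in> ?S then (\<rho> ^^ j) 0 else j)" for j
  have set: "set (support \<rho> 0) = ?S"
    unfolding support_set[OF permutation] using full funpow_mem[of 0] by auto
  have dist: "distinct (support \<rho> 0)" by (rule cycle_of_permutation[OF permutation])
  have l: "?l = Suc (2 * n)" using distinct_card[OF dist] unfolding set by simp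
  have inj: "inj_on (\<lambda>i. (\<rho> ^^ i) 0) ?S"
    using dist unfolding distinct_map l by (simp add: atLeastLessThanSuc_atLeastAtMost del: upt_Suc)
  have \<tau>0: "\<tau> 0 = 0" by (simp add: \<tau>_def)
  have \<tau>S: "\<tau> permutes ?S"
  proof (rule inj_on_imp_permutes)
    show "inj_on \<tau> ?S" using inj by (simp add: inj_on_def \<tau>_def)
    show "\<tau> ` ?S \<subseteq> ?S" using funpow_mem[of 0] by (auto simp: \<tau>_def)
  qed (auto simp: \<tau>_def)
  have \<tau>: "\<tau> permutes {1..2 * n}"
  proof (rule permutes_superset[OF \<tau>S])
    show "\<tau> x = x" if "x \<in> ?S - {1..2 * n}" for x
      using that \<tau>0 by (auto simp: not_le)
  qed
  \<comment> \<open>The orbit first returns to 0 at time \<open>2 * n + 1\<close>, so the parity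
    count is valid for every position.\<close>
  have nz: "(\<rho> ^^ k) 0 \<noteq> 0" if "0 < k" "k \<le> 2 * n" for k
    using inj_onD[OF inj, of k 0] that by auto
  have parity: "even (\<tau> j) \<longleftrightarrow> even j" if "j \<in> ?S" for j
    using even_funpow[of 0 j] nz that by (auto simp: \<tau>_def)
  have step: "\<tau> (rot (2 * n) j) = \<rho> (\<tau> j)" for j
  proof -
    consider "j < 2 * n" | "j = 2 * n" | "j > 2 * n" by linarith
    then show ?thesis
    proof cases
      case 2
      have "\<rho> ((\<rho> ^^ (2 * n)) 0) = 0"
        using least_power_of_permutation(1)[OF permutation, of 0] unfolding l by simp
      then show ?thesis using 2 by (simp add: \<tau>_def rot_def)
    qed (auto simp: \<tau>_def rot_def permutes_not_in[OF permutes])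
  qed
  have "sign \<tau> = 1"
  proof (rule sign_pairwise_permutation[OF \<tau>])
    fix j assume j: "odd j" "j \<in> {1..2 * n}"
    then show o: "odd (\<tau> j)" using parity by auto
    have "j < 2 * n" using j by (cases "j = 2 * n") auto
    then have "\<tau> (Suc j) = \<rho> (\<tau> j)" using step[of j] by (simp add: rot_def)
    also have "\<dots> = Suc (\<tau> j)"
      using o j permutes_in_image[OF \<tau>, of j] by (intro odd) auto
    finally show "\<tau> (Suc j) = Suc (\<tau> j)" .
  qed
  with \<tau> step show thesis by (intro that[of \<tau>]) auto
qed

end

text \<open>Antisymmetrizing the trace identity over the set \<open>P\<close> of paired permutations
  kills every term that is not a full cycle. The remaining terms, indexed by \<open>Q\<close>, are
  conjugate to \<open>rot\<close> by even permutations and hence all equal.\<close>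

lemma alt_walk_sum_rot:
  "alt_walk_sum {0..2 * n} {1..2 * n} n W (rot (2 * n)) = 0"
proof -
  let ?S = "{0..2 * n}" and ?c = "rot (2 * n)"
  let ?A = "alt_walk_sum ?S {1..2 * n} n W"
  define P where "P = {\<rho>. \<rho> permutes ?S \<and> (\<forall>j\<in>{j\<in>?S. odd j}. \<rho> j = Suc j)}"
  define Q where "Q = {\<rho>\<in>P. ?S \<subseteq> range (\<lambda>i. (\<rho> ^^ i) 0)}"
  have finP: "finite P"
    unfolding P_def by (rule finite_subset[OF _ finite_permutations[of ?S]]) auto
  have pp: "paired_permutation n \<rho>" if "\<rho> \<in> P" for \<rho>
    using that by unfold_locales (auto simp: P_def)
  have zero: "(\<Sum>\<rho>\<in>P. sign \<rho> * walk_sum ?S n W' \<rho>) = 0" for W'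
    unfolding P_def
  proof (rule sum_sign_walk_sum_eq_0)
    \<comment> \<open>Natural subtraction gives 0 for \<open>i = 0\<close>, so \<open>?V\<close>
      consists of 0 and the odd numbers below \<open>2 * n\<close>. These are \<open>n + 1\<close>
      indices, none of which is the successor of an odd number.\<close>
    let ?V = "(\<lambda>i. 2 * i - 1) ` {0..n}"
    have "inj_on (\<lambda>i. 2 * i - 1) {0..n}"
      by (rule inj_onI) presburger
    then show "n < card ?V" by (simp add: card_image)
    show "?V \<subseteq> ?S" by auto
    show "Suc j \<notin> ?V" if "j \<in> {j\<in>?S. odd j}" for j
    proof
      assume "Suc j \<in> ?V"
      then obtain i where "Suc j = 2 * i - 1" by auto
      then show False using that by auto presburger
    qed
  qed simp
  have "(\<Sum>\<rho>\<in>P. sign \<rho> * ?A \<rho>)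
      = (\<Sum>\<pi> | \<pi> permutes {1..2 * n}. sign \<pi> * (\<Sum>\<rho>\<in>P. sign \<rho> * walk_sum ?S n (W \<circ> \<pi>) \<rho>))"
    unfolding alt_walk_sum_def sum_distrib_left
    by (subst sum.swap) (simp add: mult_ac)
  also have "\<dots> = 0" by (simp add: zero)
  finally have "0 = (\<Sum>\<rho>\<in>P. sign \<rho> * ?A \<rho>)" by simp
  also have "\<dots> = (\<Sum>\<rho>\<in>Q. sign \<rho> * ?A \<rho>)"
  proof (rule sum.mono_neutral_right[OF finP])
    show "\<forall>\<rho>\<in>P - Q. sign \<rho> * ?A \<rho> = 0"
    proof
      fix \<rho> assume "\<rho> \<in> P - Q"
      then obtain j where "j \<in> ?S" "j \<notin> range (\<lambda>i. (\<rho> ^^ i) 0)" "\<rho> \<in> P" by (auto simp: Q_def subset_iff)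
      then show "sign \<rho> * ?A \<rho> = 0"
        using paired_permutation.alt_walk_sum_eq_0[OF pp] by simp
    qed
  qed (auto simp: Q_def)
  also have "\<dots> = (\<Sum>\<rho>\<in>Q. sign ?c * ?A ?c)"
  proof (rule sum.cong[OF refl])
    fix \<rho> assume \<rho>: "\<rho> \<in> Q"
    then interpret paired_permutation n \<rho> by (intro pp) (auto simp: Q_def)
    obtain \<tau> where \<tau>: "\<tau> permutes {1..2 * n}" "sign \<tau> = 1" "\<tau> \<circ> ?c = \<rho> \<circ> \<tau>"
      using full_cycle_conj \<rho> by (auto simp: Q_def)
    have A: "?A ?c = ?A \<rho>"
      using alt_walk_sum_conj[OF _ _ \<tau>(1) rot_permutes \<tau>(3), of n W] \<tau>(2) by simp
    have "permutation \<tau>" "permutation ?c"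
      using \<tau>(1) rot_permutes[of "2 * n"] by (auto simp: permutation_permutes)
    then have "sign ?c = sign \<rho>"
      using arg_cong[OF \<tau>(3), of sign] \<tau>(2) permutation by (simp add: sign_compose)
    with A show "sign \<rho> * ?A \<rho> = sign ?c * ?A ?c" by simp
  qed
  also have "\<dots> = int (card Q) * (sign ?c * ?A ?c)" by simp
  \<comment> \<open>The common term is isolated by cancelling the number of full cycles, which is
    possible in the integers but not in an arbitrary ring.\<close>
  finally have "card Q = 0 \<or> ?A ?c = 0" by auto
  moreover have "?c \<in> Q"
  proof -
    have "?S \<subseteq> range (\<lambda>i. (?c ^^ i) 0)"
    proof
      fix j assume "j \<in> ?S"
      then have "j = (?c ^^ j) 0" by (simp add: funpow_rot)
      then show "j \<in> range (\<lambda>i. (?c ^^ i) 0)" by (rule range_eqI)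
    qed
    moreover have "?c j = Suc j" if "j \<in> ?S" "odd j" for j
      using that by (cases "j = 2 * n") (auto simp: rot_def)
    ultimately show ?thesis using rot_permutes by (auto simp: Q_def P_def)
  qed
  moreover have "finite Q" using finP by (simp add: Q_def)
  ultimately show ?thesis by auto
qed

text \<open>The walks \<open>h\<close> from \<open>p\<close> to \<open>q\<close> are the terms of the \<open>(p, q)\<close> entry of a matrix product.\<close>

lemma amitsur_levitzki_int:
  fixes X :: "nat \<Rightarrow> nat \<Rightarrow> nat \<Rightarrow> int"
  assumes "n > 0"
  shows "(\<Sum>\<pi> | \<pi> permutes {1..2 * n}. \<Sum>h\<in>{0..2 * n} \<rightarrow>\<^sub>E {..<n}.
    sign \<pi> * of_bool (h 0 = p \<and> h (2 * n) = q) * (\<Prod>j\<in>{1..2 * n}. X (\<pi> j) (h (j - 1)) (h j))) = 0"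
proof -
  let ?S = "{0..2 * n}" and ?c = "rot (2 * n)"
  \<comment> \<open>\<open>W 0\<close> is the matrix unit with its 1 at \<open>(q, p)\<close>. The
    trace of a product with it is the \<open>(p, q)\<close> entry of the other factor.\<close>
  define W where "W i = (if i = 0 then (\<lambda>a b. of_bool (a = q \<and> b = p)) else X i)" for i
  have "walk_sum ?S n (W \<circ> \<pi>) ?c = (\<Sum>h\<in>?S \<rightarrow>\<^sub>E {..<n}.
      of_bool (h 0 = p \<and> h (2 * n) = q) * (\<Prod>j\<in>{1..2 * n}. X (\<pi> j) (h (j - 1)) (h j)))"
    if \<pi>: "\<pi> permutes {1..2 * n}" for \<pi>
  proof -
    have "\<pi> 0 = 0" using permutes_not_in[OF \<pi>] by simp
    have nz: "\<pi> j \<noteq> 0" if "j \<in> {1..2 * n}" for j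
      using permutes_in_image[OF \<pi>, of j] that by auto
    have ic: "inv_into UNIV ?c permutes ?S" by (rule permutes_inv[OF rot_permutes])
    have inv: "inv_into UNIV ?c j = (if j = 0 then 2 * n else j - 1)" if "j \<in> ?S" for j
      using that by (subst permutes_inv_eq[OF rot_permutes]) (auto simp: rot_def)
    have c: "?c j \<in> ?S" if "j \<in> ?S" for j
      using that permutes_in_image[OF rot_permutes] by blast
    have icc: "inv_into UNIV ?c (?c j) = j" for j by (rule permutes_inverses[OF rot_permutes])
    \<comment> \<open>Shifting the index map by one place turns the factor from \<open>h j\<close>
      to \<open>h (j + 1)\<close> into one from \<open>h (j - 1)\<close> to \<open>h j\<close>, the
      indexing used for walks. At \<open>j = 0\<close> the predecessor is
      \<open>2 * n\<close>.\<close>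
    have "walk_sum ?S n (W \<circ> \<pi>) ?c = (\<Sum>h\<in>?S \<rightarrow>\<^sub>E {..<n}. \<Prod>j\<in>?S.
        W (\<pi> j) (restrict (h \<circ> inv_into UNIV ?c) ?S j) (restrict (h \<circ> inv_into UNIV ?c) ?S (?c j)))"
      unfolding walk_sum_def comp_def[of W]
      by (rule sum.reindex_bij_betw[OF bij_betw_restrict_comp[OF ic], symmetric])
    also have "\<dots> = (\<Sum>h\<in>?S \<rightarrow>\<^sub>E {..<n}. \<Prod>j\<in>?S. W (\<pi> j) (h (inv_into UNIV ?c j)) (h j))"
      using c by (intro sum.cong prod.cong) (auto simp: icc)
    also have "\<dots> = (\<Sum>h\<in>?S \<rightarrow>\<^sub>E {..<n}. W (\<pi> 0) (h (2 * n)) (h 0) *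
        (\<Prod>j\<in>{1..2 * n}. W (\<pi> j) (h (j - 1)) (h j)))"
    proof (intro sum.cong refl)
      fix h
      have "?S = insert 0 {1..2 * n}" by auto
      then show "(\<Prod>j\<in>?S. W (\<pi> j) (h (inv_into UNIV ?c j)) (h j))
          = W (\<pi> 0) (h (2 * n)) (h 0) * (\<Prod>j\<in>{1..2 * n}. W (\<pi> j) (h (j - 1)) (h j))"
        by (simp add: inv)
    qed
    also have "\<dots> = (\<Sum>h\<in>?S \<rightarrow>\<^sub>E {..<n}.
        of_bool (h 0 = p \<and> h (2 * n) = q) * (\<Prod>j\<in>{1..2 * n}. X (\<pi> j) (h (j - 1)) (h j)))"
    proof (intro sum.cong arg_cong2[of _ _ _ _ "(*)"] prod.cong refl)
      show "W (\<pi> j) (h (j - 1)) (h j) = X (\<pi> j) (h (j - 1)) (h j)" if "j \<in> {1..2 * n}" for j h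
        using nz[OF that] by (simp add: W_def)
    qed (auto simp: W_def \<open>\<pi> 0 = 0\<close>)
    finally show ?thesis .
  qed
  then show ?thesis
    using alt_walk_sum_rot[of n W]
    by (simp add: alt_walk_sum_def sum_distrib_left mult.assoc)
qed

section \<open>Standard polynomials in rings\<close>

lemma (in abelian_group_hom) hom_finsum_add:
  "f \<in> A \<rightarrow> carrier G \<Longrightarrow> h (finsum G f A) = finsum H (\<lambda>x. h (f x)) A"
  by (induct A rule: infinite_finite_induct) (auto simp: Pi_def)

lemma (in abelian_group_hom) hom_add_pow_int:
  "x \<in> carrier G \<Longrightarrow> h ([k] \<cdot>\<^bsub>G\<^esub> x) = [(k :: int)] \<cdot>\<^bsub>H\<^esub> h x"
  using group_hom.hom_int_pow[OF a_group_hom] by (simp add: add_pow_def)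

lemma add_pow_int_0: "[(0 :: int)] \<cdot>\<^bsub>R\<^esub> x = \<zero>\<^bsub>R\<^esub>"
  by (simp add: add_pow_def)

lemma (in abelian_group) finsum_add_pow_int:
  assumes "finite S" "x \<in> carrier G"
  shows "(\<Oplus>s\<in>S. [(c s :: int)] \<cdot> x) = [(\<Sum>s\<in>S. c s)] \<cdot> x"
  using assms(1)
proof (induction S)
  case (insert s S)
  then show ?case using assms(2) by (simp add: add.int_pow_mult Pi_def)
qed (simp add: add_pow_int_0)

lemma (in abelian_monoid) finsum_fibres:
  assumes "finite S" "f \<in> S \<rightarrow> carrier G"
  shows "finsum G f S = (\<Oplus>g\<in>\<gamma> ` S. finsum G f {s \<in> S. \<gamma> s = g})"
proof -
  have "S = (\<Union>g\<in>\<gamma> ` S. {s \<in> S. \<gamma> s = g})" by auto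
  then have "finsum G f S = finsum G f (\<Union>g\<in>\<gamma> ` S. {s \<in> S. \<gamma> s = g})" by simp
  also have "\<dots> = (\<Oplus>g\<in>\<gamma> ` S. finsum G f {s \<in> S. \<gamma> s = g})"
    using assms by (intro add.finprod_UN_disjoint) (auto simp: pairwise_def disjnt_def)
  finally show ?thesis .
qed

text \<open>Grouping the terms by the value of \<open>\<gamma>\<close> leaves one integer
  coefficient per group. This is the bridge from identities over the integers to arbitrary
  rings.\<close>

lemma (in abelian_group) finsum_int_combination_eq_0:
  assumes S: "finite S" and \<Phi>: "\<And>s. s \<in> S \<Longrightarrow> \<Phi> (\<gamma> s) \<in> carrier G"
    and c: "\<And>g. (\<Sum>s\<in>{s \<in> S. \<gamma> s = g}. c s) = (0 :: int)"
  shows "(\<Oplus>s\<in>S. [c s] \<cdot> \<Phi> (\<gamma> s)) = \<zero>"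
proof -
  have "(\<Oplus>s\<in>{s \<in> S. \<gamma> s = g}. [c s] \<cdot> \<Phi> (\<gamma> s)) = \<zero>" if "g \<in> \<gamma> ` S" for g
  proof -
    have g: "\<Phi> g \<in> carrier G" using that \<Phi> by auto
    have "(\<Oplus>s\<in>{s \<in> S. \<gamma> s = g}. [c s] \<cdot> \<Phi> (\<gamma> s)) = (\<Oplus>s\<in>{s \<in> S. \<gamma> s = g}. [c s] \<cdot> \<Phi> g)"
      using g by (intro finsum_cong') auto
    also have "\<dots> = \<zero>" using S g by (simp add: finsum_add_pow_int c add_pow_int_0)
    finally show ?thesis .
  qed
  then have "(\<Oplus>g\<in>\<gamma> ` S. \<Oplus>s\<in>{s \<in> S. \<gamma> s = g}. [c s] \<cdot> \<Phi> (\<gamma> s)) = \<zero>"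
    by (rule add.finprod_one_eqI)
  then show ?thesis
    using S \<Phi> by (subst finsum_fibres[where \<gamma> = \<gamma>]) auto
qed

lemma (in abelian_monoid) finsum_Times:
  assumes "finite A" "finite B" "\<And>a b. a \<in> A \<Longrightarrow> b \<in> B \<Longrightarrow> f (a, b) \<in> carrier G"
  shows "finsum G f (A \<times> B) = (\<Oplus>a\<in>A. \<Oplus>b\<in>B. f (a, b))"
proof -
  have "finsum G f (\<Union>a\<in>A. Pair a ` B) = (\<Oplus>a\<in>A. finsum G f (Pair a ` B))"
    using assms by (intro add.finprod_UN_disjoint) (auto simp: pairwise_def disjnt_def)
  also have "\<dots> = (\<Oplus>a\<in>A. \<Oplus>b\<in>B. f (a, b))"
    using assms by (intro finsum_cong' add.finprod_reindex) (auto simp: inj_on_def)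
  also have "(\<Union>a\<in>A. Pair a ` B) = A \<times> B" by auto
  finally show ?thesis .
qed

lemma (in additive_subgroup) finsum_mem:
  assumes "abelian_monoid G" "f \<in> A \<rightarrow> H"
  shows "finsum G f A \<in> H"
proof -
  interpret abelian_monoid G by fact
  show ?thesis
    using assms(2) by (induct A rule: infinite_finite_induct) (auto simp: Pi_def a_Hcarr)
qed

lemma (in additive_subgroup) add_pow_int_mem:
  assumes "abelian_group G" "x \<in> H"
  shows "[(k :: int)] \<cdot>\<^bsub>G\<^esub> x \<in> H"
proof -
  interpret abelian_group G by fact
  have "x [^]\<^bsub>add_monoid G\<lparr>carrier := H\<rparr>\<^esub> k \<in> H"
    using group.int_pow_closed[OF subgroup.subgroup_is_group[OF a_subgroup a_group]] assms(2) by simp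
  then show ?thesis
    using add.int_pow_consistent[OF a_subgroup assms(2), of k] by (simp add: add_pow_def)
qed

section \<open>Ordered products and standard polynomials\<close>

definition seq_prod :: "('a, 'b) monoid_scheme \<Rightarrow> (nat \<Rightarrow> 'a) \<Rightarrow> nat \<Rightarrow> 'a" where
  "seq_prod G f k = foldr (\<otimes>\<^bsub>G\<^esub>) (map f [1..<Suc k]) \<one>\<^bsub>G\<^esub>"

lemma standard_poly_eq:
  "standard_poly A k x = (\<Oplus>\<^bsub>A\<^esub>\<pi>\<in>{\<pi>. \<pi> permutes {1..k}}. [sign \<pi>] \<cdot>\<^bsub>A\<^esub> seq_prod A (x \<circ> \<pi>) k)"
  by (simp add: standard_poly_def seq_prod_def comp_def)

context Group.monoid
begin

lemma foldr_mult:
  assumes "set xs \<subseteq> carrier G" "b \<in> carrier G"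
  shows "foldr (\<otimes>) xs \<one> \<in> carrier G" "foldr (\<otimes>) xs b = foldr (\<otimes>) xs \<one> \<otimes> b"
  using assms by (induction xs) (auto simp: m_assoc)

lemma seq_prod_0 [simp]: "seq_prod G f 0 = \<one>"
  by (simp add: seq_prod_def)

lemma seq_prod_closed: "f \<in> {1..k} \<rightarrow> carrier G \<Longrightarrow> seq_prod G f k \<in> carrier G"
  unfolding seq_prod_def by (rule foldr_mult) auto

lemma seq_prod_Suc:
  assumes "f \<in> {1..Suc k} \<rightarrow> carrier G"
  shows "seq_prod G f (Suc k) = seq_prod G f k \<otimes> f (Suc k)"
proof -
  have "foldr (\<otimes>) (map f [1..<Suc k]) (f (Suc k) \<otimes> \<one>) = foldr (\<otimes>) (map f [1..<Suc k]) \<one> \<otimes> (f (Suc k) \<otimes> \<one>)"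
    using assms by (intro foldr_mult m_closed) (auto simp: Pi_def)
  then show ?thesis
    using assms by (simp add: seq_prod_def Pi_def)
qed

lemma seq_prod_cong:
  "(\<And>i. i \<in> {1..k} \<Longrightarrow> f i = g i) \<Longrightarrow> seq_prod G f k = seq_prod G g k"
  unfolding seq_prod_def by (rule arg_cong[where f = "\<lambda>xs. foldr (\<otimes>) xs \<one>"]) auto

lemma seq_prod_add:
  assumes "f \<in> {1..k + a} \<rightarrow> carrier G"
  shows "seq_prod G f (k + a) = seq_prod G f k \<otimes> seq_prod G (\<lambda>i. f (i + k)) a"
  using assms
proof (induction a)
  case 0
  then show ?case by (simp add: seq_prod_closed)
next
  case (Suc a)
  have "seq_prod G f (k + Suc a) = seq_prod G f (k + a) \<otimes> f (Suc (k + a))"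
    using seq_prod_Suc[of f "k + a"] Suc.prems by simp
  also have "seq_prod G f (k + a) = seq_prod G f k \<otimes> seq_prod G (\<lambda>i. f (i + k)) a"
    using Suc by (auto simp: Pi_def)
  also have "\<dots> \<otimes> f (Suc (k + a)) = seq_prod G f k \<otimes> (seq_prod G (\<lambda>i. f (i + k)) a \<otimes> f (Suc (k + a)))"
    using Suc.prems by (intro m_assoc seq_prod_closed) auto
  also have "seq_prod G (\<lambda>i. f (i + k)) a \<otimes> f (Suc (k + a)) = seq_prod G (\<lambda>i. f (i + k)) (Suc a)"
    using Suc.prems by (subst seq_prod_Suc) (auto simp: add.commute)
  finally show ?case .
qed

end

lemma permutes_comp_funcset:
  assumes "\<pi> permutes A" "x \<in> A \<rightarrow> B"
  shows "x \<circ> \<pi> \<in> A \<rightarrow> B"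
  using assms permutes_in_image[OF assms(1)] by (simp add: Pi_def)

lemma (in ring) standard_poly_closed:
  assumes "x \<in> {1..k} \<rightarrow> carrier R"
  shows "standard_poly R k x \<in> carrier R"
  unfolding standard_poly_eq
  by (rule finsum_closed, rule funcsetI)
    (intro add.int_pow_closed seq_prod_closed permutes_comp_funcset assms, simp)

lemma (in ring_hom_ring) hom_seq_prod:
  assumes "f \<in> {1..k} \<rightarrow> carrier R"
  shows "h (seq_prod R f k) = seq_prod S (h \<circ> f) k"
  using assms
proof (induction k)
  case (Suc k)
  have "h \<circ> f \<in> {1..Suc k} \<rightarrow> carrier S" "f \<in> {1..k} \<rightarrow> carrier R"
    using Suc.prems by (auto simp: Pi_def)
  then show ?case
    using Suc by (simp add: R.seq_prod_Suc S.seq_prod_Suc R.seq_prod_closed Pi_def)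
qed simp

lemma (in ring_hom_ring) hom_standard_poly:
  assumes x: "x \<in> {1..k} \<rightarrow> carrier R"
  shows "h (standard_poly R k x) = standard_poly S k (h \<circ> x)"
proof -
  have x\<pi>: "x \<circ> \<pi> \<in> {1..k} \<rightarrow> carrier R" if "\<pi> \<in> {\<pi>. \<pi> permutes {1..k}}" for \<pi>
    using that x by (intro permutes_comp_funcset) auto
  have c: "[sign \<pi>] \<cdot>\<^bsub>R\<^esub> seq_prod R (x \<circ> \<pi>) k \<in> carrier R" if "\<pi> \<in> {\<pi>. \<pi> permutes {1..k}}" for \<pi>
    using x\<pi>[OF that] by (intro R.add.int_pow_closed R.seq_prod_closed)
  have eq: "h ([sign \<pi>] \<cdot>\<^bsub>R\<^esub> seq_prod R (x \<circ> \<pi>) k) = [sign \<pi>] \<cdot>\<^bsub>S\<^esub> seq_prod S (h \<circ> x \<circ> \<pi>) k"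
    if "\<pi> \<in> {\<pi>. \<pi> permutes {1..k}}" for \<pi>
    using x\<pi>[OF that] by (simp add: hom_add_pow_int R.seq_prod_closed hom_seq_prod comp_assoc)
  have "h (standard_poly R k x) = (\<Oplus>\<^bsub>S\<^esub>\<pi>\<in>{\<pi>. \<pi> permutes {1..k}}. h ([sign \<pi>] \<cdot>\<^bsub>R\<^esub> seq_prod R (x \<circ> \<pi>) k))"
    unfolding standard_poly_eq using c by (intro hom_finsum_add) auto
  also have "\<dots> = standard_poly S k (h \<circ> x)"
    unfolding standard_poly_eq
    using c eq by (intro S.finsum_cong') (auto simp: Pi_def simp flip: eq)
  finally show ?thesis .
qed

section \<open>Laplace expansion of standard polynomials\<close>

definition shift_permutation :: "nat \<Rightarrow> (nat \<Rightarrow> nat) \<Rightarrow> nat \<Rightarrow> nat" where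
  "shift_permutation k \<theta> i = (if i \<le> k then i else \<theta> (i - k) + k)"

text \<open>Building \<open>\<theta>\<close> from transpositions tracks the support and the sign
  together, since a shifted transposition is again a transposition.\<close>

lemma shift_permutation:
  assumes "\<theta> permutes {1..a}"
  shows "shift_permutation k \<theta> permutes {k + 1..k + a} \<and> sign (shift_permutation k \<theta>) = sign \<theta>"
  using assms finite_atLeastAtMost
proof (induction rule: permutes_induct)
  case id
  have "shift_permutation k id = id" by (auto simp: shift_permutation_def fun_eq_iff)
  then show ?case by (simp add: permutes_id del: id_apply)
next
  case (swap c d \<theta>)
  let ?t = "transpose (c + k) (d + k)"
  have eq: "shift_permutation k (transpose c d \<circ> \<theta>) = ?t \<circ> shift_permutation k \<theta>"
    using swap.hyps(1,2) by (auto simp: shift_permutation_def fun_eq_iff transpose_def)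
  have t: "?t permutes {k + 1..k + a}"
    using swap.hyps(1,2) by (intro permutes_swap_id) auto
  have "permutation (shift_permutation k \<theta>)" "permutation \<theta>"
    using swap.IH swap.hyps by (auto simp: permutation_permutes)
  then have "sign (?t \<circ> shift_permutation k \<theta>) = sign (transpose c d \<circ> \<theta>)"
    using swap.IH by (simp only: sign_compose permutation_swap_id) (simp add: sign_swap_id)
  moreover have "?t \<circ> shift_permutation k \<theta> permutes {k + 1..k + a}"
    using swap.IH t by (blast intro: permutes_compose)
  ultimately show ?case unfolding eq by blast
qed

text \<open>By injectivity \<open>\<eta>\<close> also preserves the last \<open>a\<close> positions.
  Its restriction to the first block is \<open>\<eta>\<^sub>1\<close>, and its restriction to the
  last block, renumbered to start at 1, is \<open>\<theta>\<close>.\<close>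

lemma permutes_split:
  assumes \<eta>: "\<eta> permutes {1..k + a}" and im: "\<eta> ` {1..k} = {1..k}"
  obtains \<eta>\<^sub>1 \<theta> where "\<eta>\<^sub>1 permutes {1..k}" "\<theta> permutes {1..a}" "\<eta> = \<eta>\<^sub>1 \<circ> shift_permutation k \<theta>"
proof -
  have mem: "\<eta> i \<in> {1..k} \<longleftrightarrow> i \<in> {1..k}" for i
    using im permutes_inj[OF \<eta>] by (metis inj_image_mem_iff)
  have memS: "\<eta> i \<in> {1..k + a} \<longleftrightarrow> i \<in> {1..k + a}" for i
    by (rule permutes_in_image[OF \<eta>])
  have inj: "\<eta> i = \<eta> j \<longleftrightarrow> i = j" for i j
    using permutes_inj[OF \<eta>] by (simp add: inj_eq)
  define \<eta>\<^sub>1 where "\<eta>\<^sub>1 i = (if i \<in> {1..k} then \<eta> i else i)" for i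
  define \<theta> where "\<theta> i = (if i \<in> {1..a} then \<eta> (i + k) - k else i)" for i
  have gt: "\<eta> i > k \<and> \<eta> i \<le> k + a" if "i > k" "i \<le> k + a" for i
    using mem[of i] memS[of i] that by auto
  have 1: "\<eta>\<^sub>1 permutes {1..k}"
  proof (rule bij_imp_permutes)
    show "bij_betw \<eta>\<^sub>1 {1..k} {1..k}"
      using im inj by (auto simp: bij_betw_def inj_on_def \<eta>\<^sub>1_def)
  qed (metis \<eta>\<^sub>1_def)
  have 2: "\<theta> permutes {1..a}"
  proof (rule bij_imp_permutes)
    have "inj_on \<theta> {1..a}"
    proof (rule inj_onI)
      fix i j assume ij: "i \<in> {1..a}" "j \<in> {1..a}" "\<theta> i = \<theta> j"
      then have "\<eta> (i + k) = \<eta> (j + k)"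
        using gt[of "i + k"] gt[of "j + k"] by (auto simp: \<theta>_def)
      then show "i = j" by (simp add: inj)
    qed
    moreover have "\<theta> ` {1..a} \<subseteq> {1..a}"
    proof
      fix y assume "y \<in> \<theta> ` {1..a}"
      then obtain i where "i \<in> {1..a}" "y = \<theta> i" by blast
      then show "y \<in> {1..a}" using gt[of "i + k"] by (auto simp: \<theta>_def)
    qed
    ultimately show "bij_betw \<theta> {1..a} {1..a}"
      by (simp add: bij_betw_def endo_inj_surj)
  qed (metis \<theta>_def)
  have "\<eta> i = (\<eta>\<^sub>1 \<circ> shift_permutation k \<theta>) i" for i
  proof -
    consider "i = 0" | "i \<in> {1..k}" | "i > k" "i \<le> k + a" | "i > k + a"
      by (cases "i = 0"; cases "i \<le> k"; cases "i \<le> k + a") auto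
    then show ?thesis
    proof cases
      case 3
      then have "i - k \<in> {1..a}" "i - k + k = i" by auto
      then show ?thesis
        using gt[OF 3] 3 by (auto simp: \<eta>\<^sub>1_def \<theta>_def shift_permutation_def)
    qed (use permutes_not_in[OF \<eta>, of i] in \<open>auto simp: \<eta>\<^sub>1_def \<theta>_def shift_permutation_def\<close>)
  qed
  then have "\<eta> = \<eta>\<^sub>1 \<circ> shift_permutation k \<theta>" by blast
  with 1 2 show thesis by (rule that)
qed

lemma (in ring) standard_poly_mult:
  assumes y: "y \<in> {1..k} \<rightarrow> carrier R" and z: "z \<in> {1..a} \<rightarrow> carrier R"
  shows "standard_poly R k y \<otimes> standard_poly R a z =
    (\<Oplus>d\<in>{\<eta>. \<eta> permutes {1..k}} \<times> {\<theta>. \<theta> permutes {1..a}}. case d of (\<eta>, \<theta>) \<Rightarrow>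
      [(sign \<eta> * sign \<theta>)] \<cdot> (seq_prod R (y \<circ> \<eta>) k \<otimes> seq_prod R (z \<circ> \<theta>) a))"
proof -
  let ?P = "\<lambda>k. {\<pi>. \<pi> permutes {1..k::nat}}"
  have fin: "finite (?P k)" for k by (simp add: finite_permutations)
  have closed: "seq_prod R (x \<circ> \<pi>) k \<in> carrier R" if "x \<in> {1..k} \<rightarrow> carrier R" "\<pi> \<in> ?P k" for x \<pi> k
    using that by (intro seq_prod_closed permutes_comp_funcset) auto
  note c = closed[OF y] closed[OF z]
  let ?f = "\<lambda>\<eta>. [sign \<eta>] \<cdot> seq_prod R (y \<circ> \<eta>) k" and ?g = "\<lambda>\<theta>. [sign \<theta>] \<cdot> seq_prod R (z \<circ> \<theta>) a"
  have "standard_poly R k y \<otimes> standard_poly R a z = (\<Oplus>\<eta>\<in>?P k. \<Oplus>\<theta>\<in>?P a. ?f \<eta> \<otimes> ?g \<theta>)"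
    unfolding standard_poly_eq using c fin
    by (subst finsum_ldistr) (auto simp: finsum_rdistr intro!: finsum_cong' finsum_closed m_closed add.int_pow_closed)
  also have "\<dots> = (\<Oplus>d\<in>?P k \<times> ?P a. case d of (\<eta>, \<theta>) \<Rightarrow> ?f \<eta> \<otimes> ?g \<theta>)"
    using c fin by (subst finsum_Times) auto
  also have "\<dots> = (\<Oplus>d\<in>?P k \<times> ?P a. case d of (\<eta>, \<theta>) \<Rightarrow> [(sign \<eta> * sign \<theta>)] \<cdot> (seq_prod R (y \<circ> \<eta>) k \<otimes> seq_prod R (z \<circ> \<theta>) a))"
    using c by (intro finsum_cong')
      (auto simp: add_pow_ldistr_int add_pow_rdistr_int add.int_pow_pow mult.commute)
  finally show ?thesis .
qed

text \<open>Laplace expansion along the first \<open>k\<close> positions: the permutations \<open>\<pi>\<close> with a given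
  image of \<open>{1..k}\<close> form a coset of \<open>S\<^sub>k \<times> S\<^sub>a\<close>, and each coset contributes
  a signed product of two standard polynomials.\<close>

lemma (in ring) standard_poly_add_mem:
  assumes L: "additive_subgroup L R"
    and x: "x \<in> {1..k + a} \<rightarrow> carrier R"
    and prod: "\<And>y z. y \<in> {1..k} \<rightarrow> carrier R \<Longrightarrow> z \<in> {1..a} \<rightarrow> carrier R \<Longrightarrow>
      standard_poly R k y \<otimes> standard_poly R a z \<in> L"
  shows "standard_poly R (k + a) x \<in> L"
proof -
  let ?P = "\<lambda>k. {\<pi>. \<pi> permutes {1..k::nat}}"
  let ?F = "\<lambda>\<pi>. [sign \<pi>] \<cdot> seq_prod R (x \<circ> \<pi>) (k + a)"
  have fin: "finite (?P k)" for k by (simp add: finite_permutations)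
  have x\<pi>: "x \<circ> \<pi> \<in> {1..k + a} \<rightarrow> carrier R" if "\<pi> \<in> ?P (k + a)" for \<pi>
    using that x by (intro permutes_comp_funcset) auto
  have F: "?F \<pi> \<in> carrier R" if "\<pi> \<in> ?P (k + a)" for \<pi>
    using x\<pi>[OF that] by (intro add.int_pow_closed seq_prod_closed)
  have fibre: "finsum R ?F {\<pi> \<in> ?P (k + a). \<pi> ` {1..k} = \<pi>\<^sub>0 ` {1..k}} \<in> L" if \<pi>\<^sub>0: "\<pi>\<^sub>0 \<in> ?P (k + a)" for \<pi>\<^sub>0
  proof -
    \<comment> \<open>\<open>y\<close> lists the arguments in the order prescribed by the coset
      representative. Its first \<open>k\<close> entries and its last \<open>a\<close> entries,
      renumbered as \<open>z\<close>, feed the two standard polynomials.\<close>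
    define y where "y = x \<circ> \<pi>\<^sub>0"
    define z where "z = (\<lambda>i. y (i + k))"
    have y: "y \<in> {1..k + a} \<rightarrow> carrier R" unfolding y_def by (rule x\<pi>[OF \<pi>\<^sub>0])
    have y': "y \<in> {1..k} \<rightarrow> carrier R" and z: "z \<in> {1..a} \<rightarrow> carrier R"
      using y by (auto simp: z_def)
    let ?D = "?P k \<times> ?P a"
    let ?j = "\<lambda>(\<eta>, \<theta>). \<pi>\<^sub>0 \<circ> (\<eta> \<circ> shift_permutation k \<theta>)"
    have \<eta>ext: "\<eta> permutes {1..k + a}" if "\<eta> \<in> ?P k" for \<eta>
      using that by (auto intro: permutes_subset)
    have \<theta>ext: "shift_permutation k \<theta> permutes {1..k + a}" if "\<theta> \<in> ?P a" for \<theta>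
      using that shift_permutation[of \<theta> a k] by (auto intro: permutes_subset)
    have inj: "inj_on ?j ?D"
    proof (rule inj_onI, clarify)
      fix \<eta> \<theta> \<eta>' \<theta>' assume h: "\<eta> permutes {1..k}" "\<theta> permutes {1..a}" "\<eta>' permutes {1..k}" "\<theta>' permutes {1..a}"
        and eq: "\<pi>\<^sub>0 \<circ> (\<eta> \<circ> shift_permutation k \<theta>) = \<pi>\<^sub>0 \<circ> (\<eta>' \<circ> shift_permutation k \<theta>')"
      have *: "\<eta> (shift_permutation k \<theta> i) = \<eta>' (shift_permutation k \<theta>' i)" for i
        using fun_cong[OF eq, of i] permutes_inj[of \<pi>\<^sub>0 "{1..k + a}"] \<pi>\<^sub>0 by (simp add: inj_eq)
      have "\<eta> i = \<eta>' i" for i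
      proof (cases "i \<in> {1..k}")
        case True
        then show ?thesis using *[of i] by (simp add: shift_permutation_def)
      next
        case False
        then show ?thesis using h by (simp add: permutes_not_in)
      qed
      moreover have "\<theta> i = \<theta>' i" for i
      proof (cases "i \<in> {1..a}")
        case True
        then have "\<theta> i \<in> {1..a}" "\<theta>' i \<in> {1..a}"
          using permutes_in_image[OF h(2)] permutes_in_image[OF h(4)] by blast+
        then have "\<eta> (\<theta> i + k) = \<theta> i + k" "\<eta>' (\<theta>' i + k) = \<theta>' i + k"
          using permutes_not_in[OF h(1), of "\<theta> i + k"] permutes_not_in[OF h(3), of "\<theta>' i + k"] by auto
        then show ?thesis using *[of "i + k"] True by (simp add: shift_permutation_def)
      next
        case False
        then show ?thesis using h by (simp add: permutes_not_in)
      qed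
      ultimately show "\<eta> = \<eta>' \<and> \<theta> = \<theta>'" by auto
    qed
    have image: "?j ` ?D = {\<pi> \<in> ?P (k + a). \<pi> ` {1..k} = \<pi>\<^sub>0 ` {1..k}}"
    proof (intro equalityI subsetI)
      fix \<pi> assume "\<pi> \<in> ?j ` ?D"
      then obtain \<eta> \<theta> where h: "\<eta> \<in> ?P k" "\<theta> \<in> ?P a" "\<pi> = \<pi>\<^sub>0 \<circ> (\<eta> \<circ> shift_permutation k \<theta>)" by auto
      have "shift_permutation k \<theta> ` {1..k} = {1..k}" by (auto simp: shift_permutation_def image_iff)
      moreover have "\<eta> ` {1..k} = {1..k}" using h(1) by (auto simp: permutes_image)
      ultimately have "\<pi> ` {1..k} = \<pi>\<^sub>0 ` {1..k}" unfolding h(3) image_comp[symmetric] by simp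
      moreover have "\<pi> \<in> ?P (k + a)"
        using h \<eta>ext \<theta>ext \<pi>\<^sub>0 by (auto intro!: permutes_compose)
      ultimately show "\<pi> \<in> {\<pi> \<in> ?P (k + a). \<pi> ` {1..k} = \<pi>\<^sub>0 ` {1..k}}" by simp
    next
      fix \<pi> assume \<pi>: "\<pi> \<in> {\<pi> \<in> ?P (k + a). \<pi> ` {1..k} = \<pi>\<^sub>0 ` {1..k}}"
      have p0: "\<pi>\<^sub>0 permutes {1..k + a}" using \<pi>\<^sub>0 by simp
      \<comment> \<open>Two permutations with the same image of \<open>{1..k}\<close> differ by one
        that preserves \<open>{1..k}\<close>, and such a permutation splits into two blocks.\<close>
      have "inv_into UNIV \<pi>\<^sub>0 \<circ> \<pi> permutes {1..k + a}"
        using \<pi> permutes_inv[OF p0] by (auto intro: permutes_compose)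
      moreover have "(inv_into UNIV \<pi>\<^sub>0 \<circ> \<pi>) ` {1..k} = {1..k}"
        using \<pi> permutes_inj[OF p0] by (simp only: image_comp[symmetric] mem_Collect_eq image_inv_f_f)
      ultimately obtain \<eta> \<theta> where h: "\<eta> permutes {1..k}" "\<theta> permutes {1..a}"
          "inv_into UNIV \<pi>\<^sub>0 \<circ> \<pi> = \<eta> \<circ> shift_permutation k \<theta>"
        by (rule permutes_split)
      have "\<pi> = \<pi>\<^sub>0 \<circ> (\<eta> \<circ> shift_permutation k \<theta>)"
        unfolding h(3)[symmetric] by (simp add: o_assoc permutes_inv_o[OF p0])
      then show "\<pi> \<in> ?j ` ?D" using h(1,2) by (intro image_eqI[of _ _ "(\<eta>, \<theta>)"]) auto
    qed
    have term_eq: "?F (?j (\<eta>, \<theta>)) =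
        [sign \<pi>\<^sub>0] \<cdot> ([(sign \<eta> * sign \<theta>)] \<cdot> (seq_prod R (y \<circ> \<eta>) k \<otimes> seq_prod R (z \<circ> \<theta>) a))"
      and term_closed: "[(sign \<eta> * sign \<theta>)] \<cdot> (seq_prod R (y \<circ> \<eta>) k \<otimes> seq_prod R (z \<circ> \<theta>) a) \<in> carrier R"
      if h: "\<eta> \<in> ?P k" "\<theta> \<in> ?P a" for \<eta> \<theta>
    proof -
      let ?s = "shift_permutation k \<theta>"
      have perm: "permutation \<pi>\<^sub>0" "permutation \<eta>" "permutation ?s"
        using \<pi>\<^sub>0 h \<theta>ext[OF h(2)] by (auto simp: permutation_permutes)
      have sgn: "sign (\<pi>\<^sub>0 \<circ> (\<eta> \<circ> ?s)) = sign \<pi>\<^sub>0 * (sign \<eta> * sign \<theta>)"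
        using perm h shift_permutation[of \<theta> a k] by (simp add: sign_compose permutation_compose)
      have "\<eta> \<circ> ?s \<in> ?P (k + a)" using \<eta>ext \<theta>ext h by (auto intro: permutes_compose)
      then have c: "y \<circ> (\<eta> \<circ> ?s) \<in> {1..k + a} \<rightarrow> carrier R"
        using y by (intro permutes_comp_funcset) auto
      have "seq_prod R (y \<circ> (\<eta> \<circ> ?s)) (k + a)
          = seq_prod R (y \<circ> (\<eta> \<circ> ?s)) k \<otimes> seq_prod R (\<lambda>i. (y \<circ> (\<eta> \<circ> ?s)) (i + k)) a"
        by (rule seq_prod_add[OF c])
      also have "seq_prod R (y \<circ> (\<eta> \<circ> ?s)) k = seq_prod R (y \<circ> \<eta>) k"
        by (rule seq_prod_cong) (simp add: shift_permutation_def)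
      also have "seq_prod R (\<lambda>i. (y \<circ> (\<eta> \<circ> ?s)) (i + k)) a = seq_prod R (z \<circ> \<theta>) a"
      proof (rule seq_prod_cong)
        fix i assume i: "i \<in> {1..a}"
        then have "\<theta> i \<in> {1..a}" using h permutes_in_image[of \<theta> "{1..a}"] by blast
        then have "\<eta> (\<theta> i + k) = \<theta> i + k"
          using h permutes_not_in[of \<eta> "{1..k}" "\<theta> i + k"] by auto
        then show "(y \<circ> (\<eta> \<circ> ?s)) (i + k) = (z \<circ> \<theta>) i"
          using i by (simp add: shift_permutation_def z_def)
      qed
      finally have eq: "seq_prod R (x \<circ> (\<pi>\<^sub>0 \<circ> (\<eta> \<circ> ?s))) (k + a) = seq_prod R (y \<circ> \<eta>) k \<otimes> seq_prod R (z \<circ> \<theta>) a"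
        by (simp only: y_def o_assoc)
      have "y \<circ> \<eta> \<in> {1..k} \<rightarrow> carrier R" "z \<circ> \<theta> \<in> {1..a} \<rightarrow> carrier R"
        using permutes_comp_funcset[OF _ y'] permutes_comp_funcset[OF _ z] h by blast+
      then have cl: "seq_prod R (y \<circ> \<eta>) k \<otimes> seq_prod R (z \<circ> \<theta>) a \<in> carrier R"
        by (intro m_closed seq_prod_closed)
      then show "[(sign \<eta> * sign \<theta>)] \<cdot> (seq_prod R (y \<circ> \<eta>) k \<otimes> seq_prod R (z \<circ> \<theta>) a) \<in> carrier R" by simp
      show "?F (?j (\<eta>, \<theta>)) =
        [sign \<pi>\<^sub>0] \<cdot> ([(sign \<eta> * sign \<theta>)] \<cdot> (seq_prod R (y \<circ> \<eta>) k \<otimes> seq_prod R (z \<circ> \<theta>) a))"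
        unfolding prod.case sgn eq using cl by (simp add: add.int_pow_pow mult_ac)
    qed
    have "finsum R ?F (?j ` ?D) = (\<Oplus>d\<in>?D. ?F (?j d))"
      using F image by (intro finsum_reindex inj) auto
    also have "\<dots> = (\<Oplus>d\<in>?D. [sign \<pi>\<^sub>0] \<cdot> (case d of (\<eta>, \<theta>) \<Rightarrow>
        [(sign \<eta> * sign \<theta>)] \<cdot> (seq_prod R (y \<circ> \<eta>) k \<otimes> seq_prod R (z \<circ> \<theta>) a)))"
      using term_eq term_closed by (intro finsum_cong') (auto simp del: o_apply)
    also have "\<dots> = [sign \<pi>\<^sub>0] \<cdot> (standard_poly R k y \<otimes> standard_poly R a z)"
    proof -
      have hom: "abelian_group_hom R R (\<lambda>u. [sign \<pi>\<^sub>0] \<cdot> u)"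
        by (intro abelian_group_homI is_abelian_group group_hom.intro group_hom_axioms.intro a_group)
          (auto simp: hom_def add.int_pow_distrib)
      show ?thesis
        unfolding standard_poly_mult[OF y' z]
        using term_closed by (intro abelian_group_hom.hom_finsum_add[OF hom, symmetric]) auto
    qed
    also have "\<dots> \<in> L"
      by (intro additive_subgroup.add_pow_int_mem[OF L] prod y' z is_abelian_group)
    finally show ?thesis unfolding image .
  qed
  have "standard_poly R (k + a) x = (\<Oplus>g\<in>(\<lambda>\<pi>. \<pi> ` {1..k}) ` ?P (k + a).
      finsum R ?F {\<pi> \<in> ?P (k + a). \<pi> ` {1..k} = g})"
    unfolding standard_poly_eq using fin F by (intro finsum_fibres) auto
  also have "\<dots> \<in> L"
    using fibre by (intro additive_subgroup.finsum_mem[OF L]) (auto intro: abelian_monoid_axioms)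
  finally show ?thesis .
qed

lemma (in ring) standard_poly_cong:
  assumes y: "y \<in> {1..k} \<rightarrow> carrier R" and eq: "\<And>i. i \<in> {1..k} \<Longrightarrow> x i = y i"
  shows "standard_poly R k x = standard_poly R k y"
  unfolding standard_poly_eq
proof (intro finsum_cong' refl)
  show "(\<lambda>\<pi>. [sign \<pi>] \<cdot> seq_prod R (y \<circ> \<pi>) k) \<in> {\<pi>. \<pi> permutes {1..k}} \<rightarrow> carrier R"
    by (rule funcsetI, intro add.int_pow_closed seq_prod_closed permutes_comp_funcset y) simp
  fix \<pi> assume \<pi>: "\<pi> \<in> {\<pi>. \<pi> permutes {1..k}}"
  have "seq_prod R (x \<circ> \<pi>) k = seq_prod R (y \<circ> \<pi>) k"
  proof (rule seq_prod_cong)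
    fix i assume "i \<in> {1..k}"
    then have "\<pi> i \<in> {1..k}" using \<pi> permutes_in_image[of \<pi>] by blast
    then show "(x \<circ> \<pi>) i = (y \<circ> \<pi>) i" using eq by simp
  qed
  then show "[sign \<pi>] \<cdot> seq_prod R (x \<circ> \<pi>) k = [sign \<pi>] \<cdot> seq_prod R (y \<circ> \<pi>) k" by simp
qed

text \<open>Laplace expansion splits off one block of \<open>a\<close> arguments at a time, and each
  block raises the filtration index by one.\<close>

lemma (in ring) standard_poly_filtration:
  assumes L: "\<And>q. additive_subgroup (L q) R" and L0: "L 0 = carrier R"
    and mult: "\<And>u v q. u \<in> L q \<Longrightarrow> v \<in> L 1 \<Longrightarrow> u \<otimes> v \<in> L (Suc q)"
    and base: "\<And>y. y \<in> {1..a} \<rightarrow> carrier R \<Longrightarrow> standard_poly R a y \<in> L 1"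
    and x: "x \<in> {1..a * q} \<rightarrow> carrier R"
  shows "standard_poly R (a * q) x \<in> L q"
  using x
proof (induction q arbitrary: x)
  case 0
  then show ?case by (simp add: L0 standard_poly_closed)
next
  case (Suc q)
  have "standard_poly R (a * q + a) x \<in> L (Suc q)"
    using Suc by (intro standard_poly_add_mem L mult base) (auto simp: add.commute)
  then show ?case by (simp add: add.commute)
qed

section \<open>The Amitsur--Levitzki theorem over commutative rings\<close>

lemma matrix_ring_entry_closed:
  "M \<in> carrier (matrix_ring n A) \<Longrightarrow> i < n \<Longrightarrow> j < n \<Longrightarrow> M $$ (i, j) \<in> carrier A"
  by (auto simp: matrix_ring_def)

lemma matrix_ring_carrier_mat: "M \<in> carrier (matrix_ring n A) \<Longrightarrow> M \<in> carrier_mat n n"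
  by (simp add: matrix_ring_def)

lemma matrix_ring_memI:
  "M \<in> carrier_mat n n \<Longrightarrow> (\<And>i j. i < n \<Longrightarrow> j < n \<Longrightarrow> M $$ (i, j) \<in> carrier A) \<Longrightarrow>
    M \<in> carrier (matrix_ring n A)"
  by (auto simp: matrix_ring_def)

lemma matrix_ring_eqI:
  "M \<in> carrier (matrix_ring n A) \<Longrightarrow> N \<in> carrier (matrix_ring n A) \<Longrightarrow>
    (\<And>i j. i < n \<Longrightarrow> j < n \<Longrightarrow> M $$ (i, j) = N $$ (i, j)) \<Longrightarrow> M = N"
  by (intro eq_matI) (auto simp: matrix_ring_def)

lemma matrix_ring_entry:
  assumes "i < n" "j < n"
  shows "(M \<otimes>\<^bsub>matrix_ring n A\<^esub> N) $$ (i, j) = (\<Oplus>\<^bsub>A\<^esub>l\<in>{..<n}. M $$ (i, l) \<otimes>\<^bsub>A\<^esub> N $$ (l, j))"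
    and "(M \<oplus>\<^bsub>matrix_ring n A\<^esub> N) $$ (i, j) = M $$ (i, j) \<oplus>\<^bsub>A\<^esub> N $$ (i, j)"
    and "\<zero>\<^bsub>matrix_ring n A\<^esub> $$ (i, j) = \<zero>\<^bsub>A\<^esub>"
    and "\<one>\<^bsub>matrix_ring n A\<^esub> $$ (i, j) = (if i = j then \<one>\<^bsub>A\<^esub> else \<zero>\<^bsub>A\<^esub>)"
  using assms by (simp_all add: matrix_ring_def)

lemma abelian_group_hom_entry:
  assumes "ring A" "i < n" "j < n"
  shows "abelian_group_hom (matrix_ring n A) A (\<lambda>M. M $$ (i, j))"
proof -
  interpret A: ring A by fact
  interpret M: ring "matrix_ring n A" by (rule ring_matrix_ring) fact
  show ?thesis
    by (intro abelian_group_homI M.is_abelian_group A.is_abelian_group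
        group_hom.intro group_hom_axioms.intro M.a_group A.a_group)
      (auto simp: hom_def matrix_ring_entry matrix_ring_entry_closed assms)
qed

text \<open>Serves two reductions of standard polynomials of matrices: modulo elements of degree at
  least 2, and from the free algebra to the Grassmann algebra.\<close>

lemma ring_hom_ring_map_mat:
  assumes "ring_hom_ring A B \<phi>"
  shows "ring_hom_ring (matrix_ring n A) (matrix_ring n B) (map_mat \<phi>)"
proof -
  interpret ring_hom_ring A B \<phi> by fact
  interpret MA: ring "matrix_ring n A" by (rule ring_matrix_ring) (rule R.ring_axioms)
  interpret MB: ring "matrix_ring n B" by (rule ring_matrix_ring) (rule S.ring_axioms)
  have car: "map_mat \<phi> M \<in> carrier (matrix_ring n B)" if "M \<in> carrier (matrix_ring n A)" for M
    using matrix_ring_carrier_mat[OF that] matrix_ring_entry_closed[OF that] by (intro matrix_ring_memI) auto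
  have ent: "map_mat \<phi> M $$ (i, j) = \<phi> (M $$ (i, j))" if "M \<in> carrier (matrix_ring n A)" "i < n" "j < n" for M i j
    using matrix_ring_carrier_mat[OF that(1)] that by auto
  show ?thesis
  proof (intro ring_hom_ringI2 ring_hom_memI MA.ring_axioms MB.ring_axioms car)
    fix M N assume MN: "M \<in> carrier (matrix_ring n A)" "N \<in> carrier (matrix_ring n A)"
    show "map_mat \<phi> (M \<otimes>\<^bsub>matrix_ring n A\<^esub> N) = map_mat \<phi> M \<otimes>\<^bsub>matrix_ring n B\<^esub> map_mat \<phi> N"
    proof (rule matrix_ring_eqI)
      fix i j assume ij: "i < n" "j < n"
      have "map_mat \<phi> (M \<otimes>\<^bsub>matrix_ring n A\<^esub> N) $$ (i, j) = \<phi> (\<Oplus>\<^bsub>A\<^esub>l\<in>{..<n}. M $$ (i, l) \<otimes>\<^bsub>A\<^esub> N $$ (l, j))"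
        using MN ij by (simp add: ent matrix_ring_entry)
      also have "\<dots> = (\<Oplus>\<^bsub>B\<^esub>l\<in>{..<n}. \<phi> (M $$ (i, l) \<otimes>\<^bsub>A\<^esub> N $$ (l, j)))"
        using MN ij by (intro hom_finsum_add) (auto simp: matrix_ring_entry_closed)
      also have "\<dots> = (\<Oplus>\<^bsub>B\<^esub>l\<in>{..<n}. map_mat \<phi> M $$ (i, l) \<otimes>\<^bsub>B\<^esub> map_mat \<phi> N $$ (l, j))"
        using MN ij by (intro S.finsum_cong') (auto simp: matrix_ring_entry_closed ent simp del: index_map_mat)
      also have "\<dots> = (map_mat \<phi> M \<otimes>\<^bsub>matrix_ring n B\<^esub> map_mat \<phi> N) $$ (i, j)"
        using ij by (simp add: matrix_ring_entry)
      finally show "map_mat \<phi> (M \<otimes>\<^bsub>matrix_ring n A\<^esub> N) $$ (i, j)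
        = (map_mat \<phi> M \<otimes>\<^bsub>matrix_ring n B\<^esub> map_mat \<phi> N) $$ (i, j)" .
    qed (use MN in \<open>auto intro: car\<close>)
    show "map_mat \<phi> (M \<oplus>\<^bsub>matrix_ring n A\<^esub> N) = map_mat \<phi> M \<oplus>\<^bsub>matrix_ring n B\<^esub> map_mat \<phi> N"
      by (rule matrix_ring_eqI) (use MN in \<open>auto intro: car simp: ent matrix_ring_entry matrix_ring_entry_closed simp del: index_map_mat\<close>)
  next
    show "map_mat \<phi> \<one>\<^bsub>matrix_ring n A\<^esub> = \<one>\<^bsub>matrix_ring n B\<^esub>"
      by (rule matrix_ring_eqI) (auto intro: car simp: ent matrix_ring_entry simp del: index_map_mat)
  qed
qed

lemma additive_subgroup_matrix_ring:
  assumes A: "ring A" and H: "additive_subgroup H A"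
  shows "additive_subgroup {M \<in> carrier (matrix_ring n A). \<forall>i<n. \<forall>j<n. M $$ (i, j) \<in> H} (matrix_ring n A)"
proof -
  interpret A: ring A by fact
  interpret M: ring "matrix_ring n A" by (rule ring_matrix_ring) fact
  interpret additive_subgroup H A by fact
  show ?thesis
  proof (rule additive_subgroupI, rule M.add.subgroupI)
    show "{M \<in> carrier (matrix_ring n A). \<forall>i<n. \<forall>j<n. M $$ (i, j) \<in> H} \<noteq> {}"
      by (auto simp: matrix_ring_entry intro!: exI[of _ "\<zero>\<^bsub>matrix_ring n A\<^esub>"])
  next
    fix N assume N: "N \<in> {M \<in> carrier (matrix_ring n A). \<forall>i<n. \<forall>j<n. M $$ (i, j) \<in> H}"
    have "(\<ominus>\<^bsub>matrix_ring n A\<^esub> N) $$ (i, j) \<in> H" if "i < n" "j < n" for i j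
      using abelian_group_hom.hom_a_inv[OF abelian_group_hom_entry[OF A that], of N] N that by simp
    then show "\<ominus>\<^bsub>matrix_ring n A\<^esub> N \<in> {M \<in> carrier (matrix_ring n A). \<forall>i<n. \<forall>j<n. M $$ (i, j) \<in> H}"
      using N by simp
  qed (auto simp: matrix_ring_entry)
qed

section \<open>Entries of matrix products as sums over walks\<close>

definition walks :: "nat \<Rightarrow> nat \<Rightarrow> nat \<Rightarrow> nat \<Rightarrow> (nat \<Rightarrow> nat) set" where
  "walks n k p q = {h \<in> {0..k} \<rightarrow>\<^sub>E {..<n}. h 0 = p \<and> h k = q}"

lemma finite_walks [simp]: "finite (walks n k p q)"
  unfolding walks_def by (rule finite_subset[of _ "{0..k} \<rightarrow>\<^sub>E {..<n}"]) (auto intro: finite_PiE)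

lemma walks_less: "h \<in> walks n k p q \<Longrightarrow> i \<le> k \<Longrightarrow> h i < n"
  by (auto simp: walks_def PiE_def Pi_def)

lemma walks_0: "p < n \<Longrightarrow> walks n 0 p q = (if p = q then {\<lambda>i\<in>{0}. p} else {})"
  by (auto simp: walks_def PiE_def extensional_def fun_eq_iff restrict_def)

text \<open>Walks are classified by the vertex \<open>l\<close> visited at time \<open>k\<close>,
  matching the summation index in the multiplication by the last matrix factor.\<close>

lemma walks_Suc:
  assumes "q < n"
  shows "walks n (Suc k) p q = (\<Union>l<n. (\<lambda>h. h(Suc k := q)) ` walks n k p l)"
proof (intro equalityI subsetI)
  fix h assume h: "h \<in> walks n (Suc k) p q"
  let ?h = "restrict h {0..k}"
  have "?h \<in> walks n k p (h k)" "h k < n"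
    using h walks_less[OF h] by (auto simp: walks_def)
  moreover have "h = ?h(Suc k := q)"
    using h by (auto simp: walks_def fun_eq_iff PiE_def extensional_def restrict_def)
  ultimately show "h \<in> (\<Union>l<n. (\<lambda>h. h(Suc k := q)) ` walks n k p l)" by blast
next
  fix h assume "h \<in> (\<Union>l<n. (\<lambda>h. h(Suc k := q)) ` walks n k p l)"
  then obtain g l where "g \<in> walks n k p l" "h = g(Suc k := q)" by blast
  then show "h \<in> walks n (Suc k) p q"
    using assms by (auto simp: walks_def PiE_def Pi_def extensional_def)
qed

lemma seq_prod_entry:
  assumes A: "ring A" and f: "f \<in> {1..k} \<rightarrow> carrier (matrix_ring n A)" and pq: "p < n" "q < n"
  shows "seq_prod (matrix_ring n A) f k $$ (p, q)
    = (\<Oplus>\<^bsub>A\<^esub>h\<in>walks n k p q. seq_prod A (\<lambda>j. f j $$ (h (j - 1), h j)) k)"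
  using f pq
proof (induction k arbitrary: q)
  case 0
  interpret A: ring A by fact
  interpret M: ring "matrix_ring n A" by (rule ring_matrix_ring) fact
  show ?case using 0 by (simp add: matrix_ring_entry walks_0)
next
  case (Suc k)
  interpret A: ring A by fact
  interpret M: ring "matrix_ring n A" by (rule ring_matrix_ring) fact
  let ?P = "\<lambda>k h. seq_prod A (\<lambda>j. f j $$ (h (j - 1), h j)) k"
  have f': "f \<in> {1..k} \<rightarrow> carrier (matrix_ring n A)" using Suc.prems(1) by auto
  have Pc: "?P i h \<in> carrier A" if "h \<in> walks n (i + d) p l" "i + d \<le> Suc k" for h i l d
  proof (intro A.seq_prod_closed funcsetI)
    fix j assume j: "j \<in> {1..i}"
    then have "f j \<in> carrier (matrix_ring n A)" using Suc.prems(1) that(2) by auto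
    then show "f j $$ (h (j - 1), h j) \<in> carrier A"
      using j walks_less[OF that(1)] by (intro matrix_ring_entry_closed) auto
  qed
  have fc: "f (Suc k) $$ (l, q) \<in> carrier A" if "l < n" for l
    using Suc.prems that by (intro matrix_ring_entry_closed) auto
  have upd: "?P (Suc k) (h(Suc k := q)) = ?P k h \<otimes>\<^bsub>A\<^esub> f (Suc k) $$ (l, q)"
    if "h \<in> walks n k p l" for h l
  proof -
    let ?h = "h(Suc k := q)"
    have hk: "h k = l" using that by (simp add: walks_def)
    have "?P (Suc k) ?h = ?P k ?h \<otimes>\<^bsub>A\<^esub> f (Suc k) $$ (?h (Suc k - 1), ?h (Suc k))"
    proof (intro A.seq_prod_Suc funcsetI)
      fix j assume "j \<in> {1..Suc k}"
      then show "f j $$ (?h (j - 1), ?h j) \<in> carrier A"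
        using Suc.prems walks_less[OF that] by (intro matrix_ring_entry_closed) auto
    qed
    moreover have "?P k ?h = ?P k h"
      by (rule A.seq_prod_cong) auto
    ultimately show ?thesis using hk by simp
  qed
  have inj: "inj_on (\<lambda>h. h(Suc k := q)) (walks n k p l)" for l
  proof (rule inj_onI)
    fix g h assume gh: "g \<in> walks n k p l" "h \<in> walks n k p l" "g(Suc k := q) = h(Suc k := q)"
    have "g i = h i" for i
    proof (cases "i = Suc k")
      case True
      then show ?thesis using gh(1,2) by (simp add: walks_def PiE_def extensional_def)
    qed (use fun_cong[OF gh(3), of i] in simp)
    then show "g = h" by blast
  qed
  have img: "(\<lambda>h. h(Suc k := q)) ` walks n k p l \<subseteq> walks n (Suc k) p q" if "l < n" for l
    using that Suc.prems(3) by (auto simp: walks_Suc)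
  have "(\<Oplus>\<^bsub>A\<^esub>h\<in>walks n (Suc k) p q. ?P (Suc k) h)
      = (\<Oplus>\<^bsub>A\<^esub>l\<in>{..<n}. \<Oplus>\<^bsub>A\<^esub>h\<in>(\<lambda>h. h(Suc k := q)) ` walks n k p l. ?P (Suc k) h)"
    unfolding walks_Suc[OF Suc.prems(3)]
  proof (rule A.add.finprod_UN_disjoint)
    let ?D = "\<lambda>l. (\<lambda>h. h(Suc k := q)) ` walks n k p l"
    show "pairwise (\<lambda>l l'. disjnt (?D l) (?D l')) {..<n}"
    proof (intro pairwiseI)
      fix l l' :: nat assume "l \<noteq> l'"
      moreover have "g k = l" if "g \<in> ?D l" for g l
        using that by (auto simp: walks_def)
      ultimately show "disjnt (?D l) (?D l')"
        unfolding disjnt_iff by blast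
    qed
    show "?P (Suc k) h \<in> carrier A" if "l \<in> {..<n}" "h \<in> ?D l" for l h
      using Pc[of h "Suc k" 0] img that by auto
  qed auto
  also have "\<dots> = (\<Oplus>\<^bsub>A\<^esub>l\<in>{..<n}. seq_prod (matrix_ring n A) f k $$ (p, l) \<otimes>\<^bsub>A\<^esub> f (Suc k) $$ (l, q))"
  proof (intro A.finsum_cong' refl funcsetI)
    fix l assume "l \<in> {..<n}"
    then have l: "l < n" by simp
    show "seq_prod (matrix_ring n A) f k $$ (p, l) \<otimes>\<^bsub>A\<^esub> f (Suc k) $$ (l, q) \<in> carrier A"
      using fc[OF l] M.seq_prod_closed[OF f'] Suc.prems l by (intro A.m_closed matrix_ring_entry_closed) auto
    have "(\<Oplus>\<^bsub>A\<^esub>h\<in>(\<lambda>h. h(Suc k := q)) ` walks n k p l. ?P (Suc k) h)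
        = (\<Oplus>\<^bsub>A\<^esub>h\<in>walks n k p l. ?P (Suc k) (h(Suc k := q)))"
    proof (intro A.finsum_reindex inj funcsetI)
      fix h assume "h \<in> (\<lambda>h. h(Suc k := q)) ` walks n k p l"
      then show "?P (Suc k) h \<in> carrier A" using Pc[of h "Suc k" 0] img[OF l] by auto
    qed
    also have "\<dots> = (\<Oplus>\<^bsub>A\<^esub>h\<in>walks n k p l. ?P k h \<otimes>\<^bsub>A\<^esub> f (Suc k) $$ (l, q))"
      using Pc[of _ k 0] fc[OF l] by (intro A.finsum_cong' refl upd) auto
    also have "\<dots> = (\<Oplus>\<^bsub>A\<^esub>h\<in>walks n k p l. ?P k h) \<otimes>\<^bsub>A\<^esub> f (Suc k) $$ (l, q)"
      using Pc[of _ k 0] fc[OF l] by (intro A.finsum_ldistr[symmetric]) auto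
    also have "(\<Oplus>\<^bsub>A\<^esub>h\<in>walks n k p l. ?P k h) = seq_prod (matrix_ring n A) f k $$ (p, l)"
      using Suc.IH[OF f' Suc.prems(2) l] by simp
    finally show "(\<Oplus>\<^bsub>A\<^esub>h\<in>(\<lambda>h. h(Suc k := q)) ` walks n k p l. ?P (Suc k) h)
        = seq_prod (matrix_ring n A) f k $$ (p, l) \<otimes>\<^bsub>A\<^esub> f (Suc k) $$ (l, q)" .
  qed
  also have "\<dots> = seq_prod (matrix_ring n A) f (Suc k) $$ (p, q)"
    using Suc.prems by (simp only: M.seq_prod_Suc matrix_ring_entry)
  finally show ?case by simp
qed

lemma (in comm_monoid) seq_prod_eq_finprod:
  assumes "f \<in> {1..k} \<rightarrow> carrier G"
  shows "seq_prod G f k = (\<Otimes>i\<in>{1..k}. f i)"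
  using assms
proof (induction k)
  case (Suc k)
  have "{1..Suc k} = insert (Suc k) {1..k}" by auto
  moreover have "(\<Otimes>i\<in>{1..k}. f i) \<in> carrier G" "f (Suc k) \<in> carrier G" "f \<in> {1..k} \<rightarrow> carrier G"
    using Suc.prems by (auto intro!: finprod_closed)
  ultimately show ?case
    using Suc by (simp only: seq_prod_Suc) (simp add: m_comm)
qed simp

lemma prod_of_bool:
  "finite A \<Longrightarrow> (\<Prod>x\<in>A. of_bool (P x) :: int) = of_bool (\<forall>x\<in>A. P x)"
  by (induction A rule: finite_induct) auto

text \<open>Each entry expands into signed monomials indexed by pairs \<open>(\<pi>, h)\<close>. By
  commutativity a monomial depends only on which entry of each \<open>x i\<close> it uses, so it
  suffices that the signs of the pairs making the same choice sum to 0. That is the integer theorem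
  for matrix units.\<close>

theorem amitsur_levitzki:
  assumes "cring A"
  shows "standard_identity (matrix_ring n A) (2 * n)"
  unfolding standard_identity_def
proof (intro allI impI)
  fix x assume x: "x \<in> {1..2 * n} \<rightarrow> carrier (matrix_ring n A)"
  interpret A: cring A by fact
  have A: "ring A" by (rule A.ring_axioms)
  interpret M: ring "matrix_ring n A" by (rule ring_matrix_ring[OF A])
  let ?S = "{1..2 * n}" and ?M = "matrix_ring n A"
  let ?P = "{\<pi>. \<pi> permutes ?S}"
  have finP: "finite ?P" by (simp add: finite_permutations)
  show "standard_poly ?M (2 * n) x = \<zero>\<^bsub>?M\<^esub>"
  proof (rule matrix_ring_eqI)
    fix p q assume pq: "p < n" "q < n"
    let ?W = "walks n (2 * n) p q"
    define \<Phi> where "\<Phi> g = (\<Otimes>\<^bsub>A\<^esub>i\<in>?S. x i $$ g i)" for g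
    \<comment> \<open>\<open>inv_into UNIV \<pi> i\<close> is the place of \<open>x i\<close> in the
      product, and \<open>\<gamma>\<close> records the step of the walk taken there. Restriction to
      \<open>?S\<close> makes equal choices equal as functions.\<close>
    define \<gamma> :: "(nat \<Rightarrow> nat) \<times> (nat \<Rightarrow> nat) \<Rightarrow> nat \<Rightarrow> nat \<times> nat" where "\<gamma> = (\<lambda>(\<pi>, h). \<lambda>i\<in>?S. (h (inv_into UNIV \<pi> i - 1), h (inv_into UNIV \<pi> i)))"
    have entry: "x i $$ (h a, h b) \<in> carrier A" if "i \<in> ?S" "h \<in> ?W" "a \<le> 2 * n" "b \<le> 2 * n" for i h a b
      using x that walks_less[OF that(2)] by (intro matrix_ring_entry_closed) auto
    have \<Phi>: "seq_prod A (\<lambda>j. x (\<pi> j) $$ (h (j - 1), h j)) (2 * n) = \<Phi> (\<gamma> (\<pi>, h))"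
      and \<Phi>_closed: "\<Phi> (\<gamma> (\<pi>, h)) \<in> carrier A"
      if \<pi>: "\<pi> \<in> ?P" and h: "h \<in> ?W" for \<pi> h
    proof -
      let ?f = "\<lambda>i. x i $$ (h (inv_into UNIV \<pi> i - 1), h (inv_into UNIV \<pi> i))"
      have p: "\<pi> permutes ?S" using \<pi> by simp
      have f: "?f i \<in> carrier A" if "i \<in> ?S" for i
      proof -
        have "inv_into UNIV \<pi> i \<in> ?S" using permutes_in_image[OF permutes_inv[OF p]] that by blast
        then show ?thesis using that h by (intro entry) auto
      qed
      have "seq_prod A (\<lambda>j. x (\<pi> j) $$ (h (j - 1), h j)) (2 * n) = (\<Otimes>\<^bsub>A\<^esub>j\<in>?S. x (\<pi> j) $$ (h (j - 1), h j))"
      proof (intro A.seq_prod_eq_finprod funcsetI)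
        fix j assume "j \<in> ?S"
        moreover have "\<pi> j \<in> ?S" using permutes_in_image[OF p] calculation by blast
        ultimately show "x (\<pi> j) $$ (h (j - 1), h j) \<in> carrier A" using h by (intro entry) auto
      qed
      also have "\<dots> = (\<Otimes>\<^bsub>A\<^esub>j\<in>?S. ?f (\<pi> j))"
        by (simp add: permutes_inverses[OF p])
      also have "\<dots> = (\<Otimes>\<^bsub>A\<^esub>i\<in>\<pi> ` ?S. ?f i)"
        by (intro A.finprod_reindex[symmetric] permutes_inj_on[OF p] funcsetI) (simp only: permutes_image[OF p] f)
      also have "\<dots> = \<Phi> (\<gamma> (\<pi>, h))"
        unfolding \<Phi>_def permutes_image[OF p] using f by (intro A.finprod_cong') (auto simp: \<gamma>_def)
      finally show "seq_prod A (\<lambda>j. x (\<pi> j) $$ (h (j - 1), h j)) (2 * n) = \<Phi> (\<gamma> (\<pi>, h))" .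
      show "\<Phi> (\<gamma> (\<pi>, h)) \<in> carrier A"
        unfolding \<Phi>_def using f by (intro A.finprod_closed) (auto simp: \<gamma>_def)
    qed
    interpret E: abelian_group_hom ?M A "\<lambda>M. M $$ (p, q)"
      by (rule abelian_group_hom_entry[OF A pq])
    have x\<pi>: "x \<circ> \<pi> \<in> ?S \<rightarrow> carrier ?M" if "\<pi> \<in> ?P" for \<pi>
      using that x by (intro permutes_comp_funcset) auto
    have "standard_poly ?M (2 * n) x $$ (p, q)
        = (\<Oplus>\<^bsub>A\<^esub>\<pi>\<in>?P. ([sign \<pi>] \<cdot>\<^bsub>?M\<^esub> seq_prod ?M (x \<circ> \<pi>) (2 * n)) $$ (p, q))"
      unfolding standard_poly_eq
      by (intro E.hom_finsum_add) (rule funcsetI, intro M.add.int_pow_closed M.seq_prod_closed x\<pi>)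
    also have "\<dots> = (\<Oplus>\<^bsub>A\<^esub>\<pi>\<in>?P. \<Oplus>\<^bsub>A\<^esub>h\<in>?W. [sign \<pi>] \<cdot>\<^bsub>A\<^esub> \<Phi> (\<gamma> (\<pi>, h)))"
    proof (intro A.finsum_cong' refl funcsetI A.finsum_closed)
      fix \<pi> assume \<pi>: "\<pi> \<in> ?P"
      have hom: "abelian_group_hom A A (\<lambda>u. [sign \<pi>] \<cdot>\<^bsub>A\<^esub> u)"
        by (intro abelian_group_homI A.is_abelian_group group_hom.intro group_hom_axioms.intro A.a_group)
          (auto simp: hom_def A.add.int_pow_distrib)
      have "([sign \<pi>] \<cdot>\<^bsub>?M\<^esub> seq_prod ?M (x \<circ> \<pi>) (2 * n)) $$ (p, q)
          = [sign \<pi>] \<cdot>\<^bsub>A\<^esub> (seq_prod ?M (x \<circ> \<pi>) (2 * n) $$ (p, q))"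
        using x\<pi>[OF \<pi>] by (intro E.hom_add_pow_int M.seq_prod_closed)
      also have "seq_prod ?M (x \<circ> \<pi>) (2 * n) $$ (p, q) = (\<Oplus>\<^bsub>A\<^esub>h\<in>?W. \<Phi> (\<gamma> (\<pi>, h)))"
        unfolding seq_prod_entry[OF A x\<pi>[OF \<pi>] pq]
        using \<Phi>[OF \<pi>] \<Phi>_closed[OF \<pi>] by (intro A.finsum_cong') (auto simp: comp_def)
      also have "[sign \<pi>] \<cdot>\<^bsub>A\<^esub> \<dots> = (\<Oplus>\<^bsub>A\<^esub>h\<in>?W. [sign \<pi>] \<cdot>\<^bsub>A\<^esub> \<Phi> (\<gamma> (\<pi>, h)))"
        using \<Phi>_closed[OF \<pi>] by (intro abelian_group_hom.hom_finsum_add[OF hom]) auto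
      finally show "([sign \<pi>] \<cdot>\<^bsub>?M\<^esub> seq_prod ?M (x \<circ> \<pi>) (2 * n)) $$ (p, q)
          = (\<Oplus>\<^bsub>A\<^esub>h\<in>?W. [sign \<pi>] \<cdot>\<^bsub>A\<^esub> \<Phi> (\<gamma> (\<pi>, h)))" .
    qed (use \<Phi>_closed in auto)
    also have "\<dots> = (\<Oplus>\<^bsub>A\<^esub>s\<in>?P \<times> ?W. [sign (fst s)] \<cdot>\<^bsub>A\<^esub> \<Phi> (\<gamma> s))"
      using finP \<Phi>_closed by (subst A.finsum_Times) auto
    also have "\<dots> = \<zero>\<^bsub>A\<^esub>"
    proof (rule A.finsum_int_combination_eq_0[where \<Phi> = \<Phi> and \<gamma> = \<gamma>])
      fix g
      show "(\<Sum>s\<in>{s \<in> ?P \<times> ?W. \<gamma> s = g}. sign (fst s)) = 0"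
      proof (cases "g \<in> extensional ?S")
        case False
        then have "{s \<in> ?P \<times> ?W. \<gamma> s = g} = {}" by (auto simp: \<gamma>_def)
        then show ?thesis by (simp only: sum.empty)
      next
        case True
        \<comment> \<open>\<open>X i\<close> is the matrix unit at position \<open>g i\<close>. The
          product of its entries along a walk is then the indicator of
          \<open>\<gamma> (\<pi>, h) = g\<close>.\<close>
        define X :: "nat \<Rightarrow> nat \<Rightarrow> nat \<Rightarrow> int" where "X i a b = of_bool (g i = (a, b))" for i a b
        have \<gamma>_eq: "of_bool (\<gamma> (\<pi>, h) = g) = (\<Prod>j\<in>?S. X (\<pi> j) (h (j - 1)) (h j))"
          if p: "\<pi> permutes ?S" for \<pi> h
        proof -
          have "\<gamma> (\<pi>, h) = g \<longleftrightarrow> (\<forall>i\<in>?S. g i = (h (inv_into UNIV \<pi> i - 1), h (inv_into UNIV \<pi> i)))"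
            using True unfolding \<gamma>_def by (auto simp: fun_eq_iff extensional_def restrict_def)
          also have "\<dots> \<longleftrightarrow> (\<forall>i\<in>\<pi> ` ?S. g i = (h (inv_into UNIV \<pi> i - 1), h (inv_into UNIV \<pi> i)))"
            by (simp only: permutes_image[OF p])
          also have "\<dots> \<longleftrightarrow> (\<forall>j\<in>?S. g (\<pi> j) = (h (j - 1), h j))"
            by (simp add: permutes_inverses[OF p])
          finally show ?thesis by (simp add: X_def prod_of_bool)
        qed
        have "(\<Sum>s\<in>{s \<in> ?P \<times> ?W. \<gamma> s = g}. sign (fst s)) = (\<Sum>s\<in>?P \<times> ?W. sign (fst s) * of_bool (\<gamma> s = g))"
          using finP by (intro sum.mono_neutral_cong_left) auto
        also have "\<dots> = (\<Sum>\<pi>\<in>?P. \<Sum>h\<in>?W. sign \<pi> * of_bool (\<gamma> (\<pi>, h) = g))"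
          unfolding sum.cartesian_product by (simp add: case_prod_unfold)
        also have "\<dots> = (\<Sum>\<pi>\<in>?P. \<Sum>h\<in>{0..2 * n} \<rightarrow>\<^sub>E {..<n}.
            sign \<pi> * of_bool (h 0 = p \<and> h (2 * n) = q) * (\<Prod>j\<in>?S. X (\<pi> j) (h (j - 1)) (h j)))"
          using \<gamma>_eq by (intro sum.cong refl sum.mono_neutral_cong_left) (auto simp: walks_def intro: finite_PiE)
        also have "\<dots> = 0"
          using pq by (intro amitsur_levitzki_int) simp
        finally show ?thesis .
      qed
    qed (use finP \<Phi>_closed in auto)
    finally show "standard_poly ?M (2 * n) x $$ (p, q) = \<zero>\<^bsub>?M\<^esub> $$ (p, q)"
      using pq by (simp add: matrix_ring_entry)
  qed (use M.standard_poly_closed[OF x] in auto)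
qed

section \<open>The degree filtration of the free algebra\<close>

lemma (in ideal) a_rcos_eq_zero_iff:
  assumes "x \<in> carrier R"
  shows "I +> x = \<zero>\<^bsub>R Quot I\<^esub> \<longleftrightarrow> x \<in> I"
proof
  show "x \<in> I" if "I +> x = \<zero>\<^bsub>R Quot I\<^esub>"
    using that assms a_coset_join1[of I x] a_subgroup by (simp add: FactRing_def)
  show "I +> x = \<zero>\<^bsub>R Quot I\<^esub>" if "x \<in> I"
    using that assms a_coset_join2[of x I] a_subgroup by (simp add: FactRing_def)
qed

lemma FactRing_carrierD:
  "X \<in> carrier (R Quot I) \<Longrightarrow> \<exists>x\<in>carrier R. X = I +>\<^bsub>R\<^esub> x"
  by (auto simp: FactRing_def A_RCOSETS_def RCOSETS_def a_r_coset_def)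

lemma (in ideal) quotient_is_cringI:
  assumes "\<And>x y. x \<in> carrier R \<Longrightarrow> y \<in> carrier R \<Longrightarrow> x \<otimes> y \<ominus> y \<otimes> x \<in> I"
  shows "cring (R Quot I)"
proof -
  interpret Q: ring "R Quot I" by (rule quotient_is_ring)
  interpret \<phi>: ring_hom_ring R "R Quot I" "(+>) I" by (rule rcos_ring_hom_ring)
  have "X \<otimes>\<^bsub>R Quot I\<^esub> Y = Y \<otimes>\<^bsub>R Quot I\<^esub> X" if "X \<in> carrier (R Quot I)" "Y \<in> carrier (R Quot I)" for X Y
  proof -
    obtain x y where xy: "x \<in> carrier R" "X = I +> x" "y \<in> carrier R" "Y = I +> y"
      using FactRing_carrierD[OF \<open>X \<in> _\<close>] FactRing_carrierD[OF \<open>Y \<in> _\<close>] by blast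
    have "I +> (x \<otimes> y) = I +> (y \<otimes> x)"
      using xy assms quotient_eq_iff_same_a_r_cos[OF ideal_axioms, of "x \<otimes> y" "y \<otimes> x"] by simp
    then show ?thesis using xy by simp
  qed
  then show ?thesis
    by (intro cring.intro comm_monoid.intro comm_monoid_axioms.intro Q.ring_axioms Q.monoid_axioms)
qed

section \<open>Degrees and monomials in the free algebra\<close>

context
  fixes R :: "('a, 'b) ring_scheme" (structure) and m :: nat
  assumes R: "cring R"
begin

interpretation cring R by (rule R)

interpretation F: ring "free_algebra R m" by (rule ring_free_algebra[OF R])

abbreviation (input) "F \<equiv> free_algebra R m"

definition degree_ge :: "nat \<Rightarrow> (nat list \<Rightarrow> 'a) set" where
  "degree_ge d = {f \<in> carrier F. \<forall>w. length w < d \<longrightarrow> f w = \<zero>}"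

definition word_monomial :: "'a \<Rightarrow> nat list \<Rightarrow> nat list \<Rightarrow> 'a" where
  "word_monomial c u = (\<lambda>w. if w = u then c else \<zero>)"

lemma free_algebra_closed: "f \<in> carrier F \<Longrightarrow> f w \<in> carrier R"
  by (auto simp: free_algebra_def)

lemma free_algebra_apply:
  "(f \<otimes>\<^bsub>F\<^esub> g) w = (\<Oplus>i\<in>{..length w}. f (take i w) \<otimes> g (drop i w))"
  "(f \<oplus>\<^bsub>F\<^esub> g) w = f w \<oplus> g w" "\<zero>\<^bsub>F\<^esub> w = \<zero>"
  by (simp_all add: free_algebra_def)

lemma free_algebra_minus_apply:
  assumes "f \<in> carrier F"
  shows "(\<ominus>\<^bsub>F\<^esub> f) w = \<ominus> f w"
proof -
  have "(\<ominus>\<^bsub>F\<^esub> f) w \<oplus> f w = \<zero>"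
    using F.l_neg[OF assms] by (metis free_algebra_apply(2,3))
  then show ?thesis
    using assms by (intro minus_equality[symmetric]) (auto intro: free_algebra_closed)
qed

lemma degree_ge_mult:
  assumes f: "f \<in> degree_ge c" and g: "g \<in> degree_ge d"
  shows "f \<otimes>\<^bsub>F\<^esub> g \<in> degree_ge (c + d)"
proof -
  have fg: "f \<in> carrier F" "g \<in> carrier F" using f g by (auto simp: degree_ge_def)
  have "(f \<otimes>\<^bsub>F\<^esub> g) w = \<zero>" if "length w < c + d" for w
    unfolding free_algebra_apply
  proof (rule add.finprod_one_eqI)
    fix i assume "i \<in> {..length w}"
    then have "length (take i w) < c \<or> length (drop i w) < d" using that by auto
    then have "f (take i w) = \<zero> \<or> g (drop i w) = \<zero>" using f g by (auto simp: degree_ge_def)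
    then show "f (take i w) \<otimes> g (drop i w) = \<zero>" using fg by (auto simp: free_algebra_closed)
  qed
  then show ?thesis using fg by (auto simp: degree_ge_def)
qed

lemma degree_ge_0: "degree_ge 0 = carrier F"
  by (simp add: degree_ge_def)

lemma ideal_degree_ge: "ideal (degree_ge d) F"
proof (rule idealI)
  show "subgroup (degree_ge d) (add_monoid F)"
  proof (rule F.add.subgroupI)
    show "degree_ge d \<noteq> {}"
      by (auto simp: degree_ge_def free_algebra_apply intro!: exI[of _ "\<zero>\<^bsub>F\<^esub>"])
  qed (auto simp: degree_ge_def free_algebra_apply free_algebra_minus_apply)
  show "x \<otimes>\<^bsub>F\<^esub> a \<in> degree_ge d" if "a \<in> degree_ge d" "x \<in> carrier F" for a x
    using degree_ge_mult[of x 0 a d] that by (simp add: degree_ge_0)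
  show "a \<otimes>\<^bsub>F\<^esub> x \<in> degree_ge d" if "a \<in> degree_ge d" "x \<in> carrier F" for a x
    using degree_ge_mult[of a d x 0] that by (simp add: degree_ge_0)
qed (rule F.ring_axioms)

text \<open>Only words of length 0 and 1 need checking. There the coefficients of a product are
  \<open>f [] \<otimes> g []\<close> and
  \<open>f [] \<otimes> g [a] \<oplus> f [a] \<otimes> g []\<close>, which are symmetric because
  \<open>R\<close> is commutative.\<close>

lemma commutator_degree_ge_2:
  assumes f: "f \<in> carrier F" and g: "g \<in> carrier F"
  shows "f \<otimes>\<^bsub>F\<^esub> g \<ominus>\<^bsub>F\<^esub> g \<otimes>\<^bsub>F\<^esub> f \<in> degree_ge 2"
proof -
  have c: "f w \<in> carrier R" "g w \<in> carrier R" for w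
    using f g by (auto intro: free_algebra_closed)
  have "(f \<otimes>\<^bsub>F\<^esub> g) w = (g \<otimes>\<^bsub>F\<^esub> f) w" if "length w < 2" for w
  proof -
    have "w = [] \<or> (\<exists>a. w = [a])"
      using that by (cases w; cases "tl w") auto
    then show ?thesis
    proof (elim disjE exE)
      assume "w = []"
      then show ?thesis using c by (simp add: free_algebra_apply m_comm)
    next
      fix a assume "w = [a]"
      then show ?thesis using c by (simp add: free_algebra_apply m_comm a_comm)
    qed
  qed
  then have "(f \<otimes>\<^bsub>F\<^esub> g \<ominus>\<^bsub>F\<^esub> g \<otimes>\<^bsub>F\<^esub> f) w = \<zero>" if "length w < 2" for w
    using that f g
    by (simp add: F.minus_eq free_algebra_apply(2) free_algebra_minus_apply r_neg free_algebra_closed)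
  then show ?thesis using f g by (simp add: degree_ge_def)
qed

lemma word_monomial_closed:
  assumes "c \<in> carrier R" "set u \<subseteq> {1..m}"
  shows "word_monomial c u \<in> carrier F"
proof -
  have "finite {w. word_monomial c u w \<noteq> \<zero>}"
    by (rule finite_subset[of _ "{u}"]) (auto simp: word_monomial_def)
  then show ?thesis
    using assms by (auto simp: free_algebra_def word_monomial_def split: if_splits)
qed

lemma word_monomial_mult:
  assumes "c \<in> carrier R" "d \<in> carrier R"
  shows "word_monomial c u \<otimes>\<^bsub>F\<^esub> word_monomial d v = word_monomial (c \<otimes> d) (u @ v)"
proof
  fix w
  have "(word_monomial c u \<otimes>\<^bsub>F\<^esub> word_monomial d v) w
      = (\<Oplus>i\<in>{..length w}. if i = length u \<and> w = u @ v then c \<otimes> d else \<zero>)"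
    unfolding free_algebra_apply
  proof (intro finsum_cong' refl funcsetI)
    fix i assume i: "i \<in> {..length w}"
    have "take i w = u \<and> drop i w = v \<longleftrightarrow> i = length u \<and> w = u @ v"
      using i by (metis append_eq_conv_conj append_take_drop_id atMost_iff length_take min.absorb2)
    then show "word_monomial c u (take i w) \<otimes> word_monomial d v (drop i w)
        = (if i = length u \<and> w = u @ v then c \<otimes> d else \<zero>)"
      using assms by (auto simp: word_monomial_def)
  qed (use assms in auto)
  also have "\<dots> = word_monomial (c \<otimes> d) (u @ v) w"
  proof (cases "w = u @ v")
    case True
    then have "(\<Oplus>i\<in>{..length w}. if i = length u \<and> w = u @ v then c \<otimes> d else \<zero>)
        = (\<Oplus>i\<in>{..length w}. if length u = i then c \<otimes> d else \<zero>)"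
      using assms by (intro finsum_cong') auto
    also have "\<dots> = c \<otimes> d"
      using True assms by (intro finsum_singleton) auto
    finally show ?thesis using True by (simp add: word_monomial_def)
  qed (simp add: word_monomial_def finsum_zero)
  finally show "(word_monomial c u \<otimes>\<^bsub>F\<^esub> word_monomial d v) w = word_monomial (c \<otimes> d) (u @ v) w" .
qed

lemma free_var_eq: "free_var R i = word_monomial \<one> [i]"
  by (simp add: free_var_def word_monomial_def)

section \<open>Words that vanish modulo the Grassmann relations\<close>

context
  fixes I
  assumes I: "ideal I F" and relations: "grassmann_relations R m \<subseteq> I"
begin

interpretation I: ideal I F by (rule I)

lemma square_mem: "1 \<le> a \<Longrightarrow> a \<le> m \<Longrightarrow> word_monomial \<one> [a, a] \<in> I"
  using relations
  by (auto simp: grassmann_relations_def Let_def free_var_eq word_monomial_mult)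

lemma anticommutator_mem:
  assumes "a \<in> {1..m}" "b \<in> {1..m}" "a \<noteq> b"
  shows "word_monomial \<one> [a, b] \<oplus>\<^bsub>F\<^esub> word_monomial \<one> [b, a] \<in> I"
proof -
  have lt: "word_monomial \<one> [a, b] \<oplus>\<^bsub>F\<^esub> word_monomial \<one> [b, a] \<in> I"
    if "1 \<le> a" "a < b" "b \<le> m" for a b
    using relations that
    by (auto simp: grassmann_relations_def Let_def free_var_eq word_monomial_mult subset_iff) 
  have comm: "word_monomial \<one> [a, b] \<oplus>\<^bsub>F\<^esub> word_monomial \<one> [b, a]
      = word_monomial \<one> [b, a] \<oplus>\<^bsub>F\<^esub> word_monomial \<one> [a, b]"
    using assms by (intro F.a_comm word_monomial_closed) auto
  show ?thesis
  proof (cases "a < b")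
    case True
    then show ?thesis using lt[of a b] assms by auto
  next
    case False
    then show ?thesis unfolding comm using lt[of b a] assms by auto
  qed
qed

text \<open>Induction on the letters between the two copies of \<open>a\<close>: anticommutation
  moves the first copy past its neighbour until the copies meet in a square.\<close>

lemma repeated_letter_mem:
  assumes "set (a # s) \<subseteq> {1..m}"
  shows "word_monomial \<one> (a # s @ [a]) \<in> I"
  using assms
proof (induction s)
  case Nil
  then show ?case using square_mem[of a] by simp
next
  case (Cons b s)
  show ?case
  proof (cases "b = a")
    case True
    have "word_monomial \<one> [a, a] \<otimes>\<^bsub>F\<^esub> word_monomial \<one> (s @ [a]) \<in> I"
      using Cons.prems by (intro I.I_r_closed square_mem word_monomial_closed) auto
    then show ?thesis using True by (simp add: word_monomial_mult)
  next
    case False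
    let ?x = "word_monomial \<one> (a # b # s @ [a])" and ?y = "word_monomial \<one> (b # a # s @ [a])"
    have xy: "?x \<in> carrier F" "?y \<in> carrier F"
      using Cons.prems by (auto intro!: word_monomial_closed)
    have c: "word_monomial \<one> [a, b] \<in> carrier F" "word_monomial \<one> [b, a] \<in> carrier F"
        "word_monomial \<one> (s @ [a]) \<in> carrier F" "word_monomial \<one> [b] \<in> carrier F"
      using Cons.prems by (auto intro!: word_monomial_closed)
    \<comment> \<open>The anticommutator of \<open>a\<close> and \<open>b\<close> puts the sum of
      \<open>?x\<close> and \<open>?y\<close> into \<open>I\<close>. Since \<open>?y\<close> is
      \<open>b\<close> times a shorter instance, \<open>?x\<close> follows by subtraction.\<close>
    have "(word_monomial \<one> [a, b] \<oplus>\<^bsub>F\<^esub> word_monomial \<one> [b, a]) \<otimes>\<^bsub>F\<^esub> word_monomial \<one> (s @ [a]) \<in> I"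
      using Cons.prems False c by (intro I.I_r_closed anticommutator_mem) auto
    then have sum: "?x \<oplus>\<^bsub>F\<^esub> ?y \<in> I"
      using c by (simp add: F.l_distr word_monomial_mult)
    have "word_monomial \<one> [b] \<otimes>\<^bsub>F\<^esub> word_monomial \<one> (a # s @ [a]) \<in> I"
      using Cons c by (intro I.I_l_closed) auto
    then have "?y \<in> I" by (simp add: word_monomial_mult)
    then have "(?x \<oplus>\<^bsub>F\<^esub> ?y) \<oplus>\<^bsub>F\<^esub> \<ominus>\<^bsub>F\<^esub> ?y \<in> I"
      by (intro I.a_closed[OF sum] I.a_inv_closed)
    also have "(?x \<oplus>\<^bsub>F\<^esub> ?y) \<oplus>\<^bsub>F\<^esub> \<ominus>\<^bsub>F\<^esub> ?y = ?x"
      using xy by (simp add: F.a_assoc F.r_neg)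
    finally show ?thesis by simp
  qed
qed

lemma not_distinct_mem:
  assumes "\<not> distinct w" "set w \<subseteq> {1..m}" "c \<in> carrier R"
  shows "word_monomial c w \<in> I"
proof -
  obtain xs ys zs a where w: "w = xs @ [a] @ ys @ [a] @ zs"
    using not_distinct_decomp[OF assms(1)] by blast
  have "word_monomial c xs \<otimes>\<^bsub>F\<^esub> (word_monomial \<one> (a # ys @ [a]) \<otimes>\<^bsub>F\<^esub> word_monomial \<one> zs) \<in> I"
    using assms(2,3) w by (intro I.I_l_closed I.I_r_closed repeated_letter_mem word_monomial_closed) auto
  then show ?thesis using assms(3) w by (simp add: word_monomial_mult)
qed

text \<open>A finitely supported function is the sum of its monomials; the induction removes them
  one at a time.\<close>

lemma support_mem:
  assumes "finite S" "f \<in> carrier F" "\<And>w. f w \<noteq> \<zero> \<Longrightarrow> w \<in> S" "\<And>w. w \<in> S \<Longrightarrow> word_monomial (f w) w \<in> I"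
  shows "f \<in> I"
  using assms
proof (induction S arbitrary: f rule: finite_induct)
  case empty
  then have "f = \<zero>\<^bsub>F\<^esub>" by (auto simp: free_algebra_apply fun_eq_iff)
  then show ?case by simp
next
  case (insert u S)
  let ?g = "f(u := \<zero>)"
  have "finite {w. ?g w \<noteq> \<zero>}"
    by (rule finite_subset[of _ "{w. f w \<noteq> \<zero>}"]) (use insert.prems(1) in \<open>auto simp: free_algebra_def\<close>)
  then have g: "?g \<in> carrier F"
    using insert.prems(1) by (auto simp: free_algebra_def)
  have "?g \<in> I"
  proof (rule insert.IH[OF g])
    show "w \<in> S" if "?g w \<noteq> \<zero>" for w
      using that insert.prems(2)[of w] by (auto split: if_splits)
    show "word_monomial (?g w) w \<in> I" if "w \<in> S" for w
      using that insert.prems(3)[of w] insert.hyps by auto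
  qed
  then have "word_monomial (f u) u \<oplus>\<^bsub>F\<^esub> ?g \<in> I"
    using insert.prems(3) by (intro I.a_closed) auto
  also have "word_monomial (f u) u \<oplus>\<^bsub>F\<^esub> ?g = f"
    using free_algebra_closed[OF insert.prems(1)]
    by (auto simp: fun_eq_iff free_algebra_apply word_monomial_def)
  finally show ?case .
qed

lemma degree_ge_Suc_subset: "degree_ge (Suc m) \<subseteq> I"
proof
  fix f assume f: "f \<in> degree_ge (Suc m)"
  show "f \<in> I"
  proof (rule support_mem)
    show "finite {w. f w \<noteq> \<zero>}" "f \<in> carrier F" using f by (auto simp: degree_ge_def free_algebra_def)
    fix w assume nz: "w \<in> {w. f w \<noteq> \<zero>}"
    then have "\<not> length w < Suc m" using f by (auto simp: degree_ge_def)
    then have w: "set w \<subseteq> {1..m}" "length w > m" "f w \<in> carrier R"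
      using f nz by (auto simp: degree_ge_def free_algebra_def)
    have "card (set w) \<le> m" using card_mono[OF _ w(1)] by simp
    then have "\<not> distinct w" using w(2) distinct_card[of w] by auto
    then show "word_monomial (f w) w \<in> I" using w by (intro not_distinct_mem)
  qed simp
qed

end

text \<open>The filtration step is applied to blocks of \<open>2 * n\<close> matrices. Each block
  contributes degree 2, so \<open>q\<close> blocks contribute \<open>2 * q\<close>.\<close>

lemma standard_poly_free_algebra_entry:
  assumes y: "y \<in> {1..2 * n * q} \<rightarrow> carrier (matrix_ring n F)" and ij: "i < n" "j < n"
  shows "standard_poly (matrix_ring n F) (2 * n * q) y $$ (i, j) \<in> degree_ge (2 * q)"
proof -
  let ?M = "matrix_ring n F"
  interpret M: ring ?M by (rule ring_matrix_ring[OF F.ring_axioms])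
  define L where "L q = {M \<in> carrier ?M. \<forall>i<n. \<forall>j<n. M $$ (i, j) \<in> degree_ge (2 * q)}" for q
  have "standard_poly ?M (2 * n * q) y \<in> L q"
  proof (rule M.standard_poly_filtration[OF _ _ _ _ y])
    show "additive_subgroup (L q) ?M" for q
      unfolding L_def
      by (intro additive_subgroup_matrix_ring F.ring_axioms ideal.axioms(1)[OF ideal_degree_ge])
    show "L 0 = carrier ?M" by (auto simp: L_def degree_ge_0 matrix_ring_entry_closed)
    show "u \<otimes>\<^bsub>?M\<^esub> v \<in> L (Suc q)" if u: "u \<in> L q" and v: "v \<in> L 1" for u v q
    proof -
      have "(u \<otimes>\<^bsub>?M\<^esub> v) $$ (i, j) \<in> degree_ge (2 * Suc q)" if "i < n" "j < n" for i j
        unfolding matrix_ring_entry(1)[OF that]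
      proof (intro additive_subgroup.finsum_mem[OF ideal.axioms(1)[OF ideal_degree_ge]] F.abelian_monoid_axioms funcsetI)
        fix l assume "l \<in> {..<n}"
        then have "u $$ (i, l) \<in> degree_ge (2 * q)" "v $$ (l, j) \<in> degree_ge 2"
          using u v that by (auto simp: L_def)
        then show "u $$ (i, l) \<otimes>\<^bsub>F\<^esub> v $$ (l, j) \<in> degree_ge (2 * Suc q)"
          using degree_ge_mult by fastforce
      qed
      then show ?thesis using u v by (auto simp: L_def)
    qed
    \<comment> \<open>One block: modulo degree at least 2 the entries commute, so the
      Amitsur--Levitzki theorem makes the reduced standard polynomial vanish, and its entries lie in
      the ideal divided out.\<close>
    fix z assume z: "z \<in> {1..2 * n} \<rightarrow> carrier ?M"
    interpret J: ideal "degree_ge 2" F by (rule ideal_degree_ge)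
    let ?Q = "F Quot degree_ge 2" and ?\<psi> = "(+>\<^bsub>F\<^esub>) (degree_ge 2)"
    interpret \<Psi>: ring_hom_ring ?M "matrix_ring n ?Q" "map_mat ?\<psi>"
      by (rule ring_hom_ring_map_mat[OF J.rcos_ring_hom_ring])
    have Q: "cring ?Q" by (rule J.quotient_is_cringI) (rule commutator_degree_ge_2)
    let ?s = "standard_poly ?M (2 * n) z"
    have s: "?s \<in> carrier ?M" using z by (rule M.standard_poly_closed)
    have "map_mat ?\<psi> ?s = standard_poly (matrix_ring n ?Q) (2 * n) (map_mat ?\<psi> \<circ> z)"
      using z by (rule \<Psi>.hom_standard_poly)
    also have "\<dots> = \<zero>\<^bsub>matrix_ring n ?Q\<^esub>"
      using amitsur_levitzki[OF Q, of n] z unfolding standard_identity_def by (auto simp: Pi_def)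
    finally have 0: "map_mat ?\<psi> ?s = \<zero>\<^bsub>matrix_ring n ?Q\<^esub>" .
    have "?s $$ (i, j) \<in> degree_ge 2" if "i < n" "j < n" for i j
    proof -
      have "?\<psi> (?s $$ (i, j)) = map_mat ?\<psi> ?s $$ (i, j)"
        using matrix_ring_carrier_mat[OF s] that by auto
      also have "\<dots> = \<zero>\<^bsub>?Q\<^esub>" unfolding 0 by (rule matrix_ring_entry(3)[OF that])
      finally show ?thesis
        using J.a_rcos_eq_zero_iff matrix_ring_entry_closed[OF s that] by blast
    qed
    then show "?s \<in> L 1" using s by (simp add: L_def)
  qed
  then show ?thesis using ij by (simp add: L_def)
qed

end

section \<open>The standard identity over the Grassmann algebra\<close>

theorem proposition8:
  fixes R :: "('a, 'b) ring_scheme" and m n :: nat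
  assumes "cring R" and "n \<ge> 1"
  shows "standard_identity (matrix_ring n (grassmann_algebra R m)) (2 * n * (m div 2 + 1))"
  unfolding standard_identity_def
proof (intro allI impI)
  let ?F = "free_algebra R m" and ?E = "grassmann_algebra R m"
  let ?q = "m div 2 + 1"
  let ?k = "2 * n * ?q"
  fix x assume x: "x \<in> {1..?k} \<rightarrow> carrier (matrix_ring n ?E)"
  define I where "I = Idl\<^bsub>?F\<^esub> (grassmann_relations R m)"
  interpret F: ring ?F by (rule ring_free_algebra[OF assms(1)])
  interpret I: ideal I ?F unfolding I_def by (rule ideal_grassmann_relations[OF assms(1)])
  have E: "?E = ?F Quot I" by (simp add: grassmann_algebra_def I_def)
  let ?\<phi> = "(+>\<^bsub>?F\<^esub>) I"
  interpret \<Phi>: ring_hom_ring "matrix_ring n ?F" "matrix_ring n ?E" "map_mat ?\<phi>"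
    unfolding E by (rule ring_hom_ring_map_mat[OF I.rcos_ring_hom_ring])
  have relations: "grassmann_relations R m \<subseteq> I"
  proof -
    have "grassmann_relations R m \<subseteq> carrier ?F"
      by (auto simp: grassmann_relations_def Let_def intro!: F.m_closed F.a_closed free_var_closed[OF assms(1)])
    then show ?thesis unfolding I_def by (rule F.genideal_self)
  qed
  \<comment> \<open>\<open>2 * ?q\<close> is \<open>m + 2\<close> for even \<open>m\<close> and
    \<open>m + 1\<close> for odd \<open>m\<close>, hence at least \<open>Suc m\<close>.\<close>
  have subset: "degree_ge R m (2 * ?q) \<subseteq> I"
  proof -
    have "degree_ge R m (2 * ?q) \<subseteq> degree_ge R m (Suc m)"
      by (auto simp: degree_ge_def[OF assms(1)])
    also have "\<dots> \<subseteq> I"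
      by (rule degree_ge_Suc_subset[OF assms(1) I.ideal_axioms relations])
    finally show ?thesis .
  qed
  \<comment> \<open>A chosen representative of each coset, applied entrywise, lifts the given
    matrices to matrices over the free algebra, where degrees make sense.\<close>
  define lift where "lift e = (SOME f. f \<in> carrier ?F \<and> ?\<phi> f = e)" for e
  have lift: "lift e \<in> carrier ?F \<and> ?\<phi> (lift e) = e" if "e \<in> carrier ?E" for e
  proof -
    have "\<exists>f. f \<in> carrier ?F \<and> ?\<phi> f = e"
      using FactRing_carrierD[of e ?F I] that unfolding E by blast
    then show ?thesis unfolding lift_def by (rule someI_ex)
  qed
  define y where "y i = map_mat lift (x i)" for i
  have xi: "x i \<in> carrier (matrix_ring n ?E)" if "i \<in> {1..?k}" for i
    using x that by auto
  have y: "y i \<in> carrier (matrix_ring n ?F)" "map_mat ?\<phi> (y i) = x i" if "i \<in> {1..?k}" for i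
  proof -
    note car = matrix_ring_carrier_mat[OF xi[OF that]]
    show "y i \<in> carrier (matrix_ring n ?F)"
      unfolding y_def using car lift matrix_ring_entry_closed[OF xi[OF that]]
      by (intro matrix_ring_memI) auto
    show "map_mat ?\<phi> (y i) = x i"
      unfolding y_def using car lift matrix_ring_entry_closed[OF xi[OF that]]
      by (intro eq_matI) auto
  qed
  have yc: "y \<in> {1..?k} \<rightarrow> carrier (matrix_ring n ?F)" using y(1) by blast
  let ?s = "standard_poly (matrix_ring n ?F) ?k y"
  have s: "?s \<in> carrier (matrix_ring n ?F)" using yc by (rule \<Phi>.R.standard_poly_closed)
  \<comment> \<open>The lifts reproduce \<open>x\<close> only at the indices in
    \<open>{1..?k}\<close>, so a congruence over these indices replaces an equality of
    functions.\<close>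
  have "standard_poly (matrix_ring n ?E) ?k x = standard_poly (matrix_ring n ?E) ?k (map_mat ?\<phi> \<circ> y)"
  proof (rule \<Phi>.S.standard_poly_cong)
    show "map_mat ?\<phi> \<circ> y \<in> {1..?k} \<rightarrow> carrier (matrix_ring n ?E)"
      using y(2) xi by (intro funcsetI) (simp only: o_apply)
  qed (simp only: o_apply y(2))
  also have "\<dots> = map_mat ?\<phi> ?s"
    using yc by (rule \<Phi>.hom_standard_poly[symmetric])
  also have "\<dots> = \<zero>\<^bsub>matrix_ring n ?E\<^esub>"
  proof (rule matrix_ring_eqI)
    fix i j assume ij: "i < n" "j < n"
    have "?s $$ (i, j) \<in> I"
      using standard_poly_free_algebra_entry[OF assms(1) yc ij] subset by blast
    then have "?\<phi> (?s $$ (i, j)) = \<zero>\<^bsub>?E\<^esub>"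
      unfolding E using I.a_rcos_eq_zero_iff[of "?s $$ (i, j)"] by simp
    then show "map_mat ?\<phi> ?s $$ (i, j) = \<zero>\<^bsub>matrix_ring n ?E\<^esub> $$ (i, j)"
      using matrix_ring_carrier_mat[OF s] ij by (simp add: matrix_ring_entry)
  qed (use s in auto)
  finally show "standard_poly (matrix_ring n ?E) ?k x = \<zero>\<^bsub>matrix_ring n ?E\<^esub>" .
qed

end
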